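(* Let $i\ge 0$ be an integer and let $\mathcal I=(I_n)_{n\ge 1}$ be an $\mathrm{Inc}^i$-invariant chain of monomial ideals $I_n\subseteq R_n$. Then there exists an integer $D(\mathcal I)$ such that $$\operatorname{codim} I_n=\gamma_i(\mathcal I)\,n+D(\mathcal I)\quad\text{for all } n\gg 0 .$$
   Context: Fix an integer $c\ge 1$ and a field $K$; let $\mathbb N$ be the set of positive integers and $[c]=\{1,\dots,c\}$. For $n\ge1$ let $R_n=K[x_{k,j}\mid 1\le k\le c,\ 1\le j\le n]$ and $R=\bigcup_{n\ge1}R_n$. For an integer $i\ge0$ let $\mathrm{Inc}^i$ be the monoid of all strictly increasing maps $\pi:\mathbb N\to\mathbb N$ with $\pi(j)=j$ for all $j\le i$; it acts on $R$ by $K$-algebra endomorphisms via $\pi\cdot x_{k,j}=x_{k,\pi(j)}$. For $m\le n$ put $\mathrm{Inc}^i_{m,n}=\{\pi\in\mathrm{Inc}^i\mid \pi(m)\le n\}$. A chain $\mathcal I=(I_n)_{n\ge1}$ of ideals $I_n\subseteq R_n$ is $\mathrm{Inc}^i$-invariant if $\pi(f)\in I_n$ for all $m\le n$, $f\in I_m$, $\pi\in\mathrm{Inc}^i_{m,n}$. For such a chain there is an integer $r\ge1$ such that for all $n\ge r$ the ideal $I_n$ of $R_n$ is generated by $\{\pi(f)\mid f\in I_r,\ \pi\in\mathrm{Inc}^i_{r,n}\}$ (known); the least such $r$ is denoted $\mathrm{ind}^i(\mathcal I)$. For a monomial $u\ne1$, $\min(u)$ is the smallest index $j$ such that some $x_{k,j}$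 divides $u$. For a proper monomial ideal $J\subsetneq R_n$ with minimal set of monomial generators $G(J)$, let $G_i^+(J)=\{u\in G(J)\mid \min(u)>i\}$. A set $C\subseteq[c]$ covers a monomial $u$ if there is $k\in C$ such that $x_{k,j}$ divides $u$ for some $j\ge1$; $C$ is an $i$-cover of $J$ if it covers every element of $G_i^+(J)$. Put $\gamma_i(J)=\min\{\#C\mid C\text{ is an }i\text{-cover of }J\}$, and $\gamma_i(R_n)=\infty$. For an $\mathrm{Inc}^i$-invariant chain $\mathcal I$ of monomial ideals, $\gamma_i(I_n)$ is the same for all $n\ge\mathrm{ind}^i(\mathcal I)$, and $\gamma_i(\mathcal I)$ denotes this common value. $\operatorname{codim}$ denotes codimension (height) of an ideal of $R_n$; by convention $\operatorname{codim} R_n=\infty$ (and $\infty\cdot n+D=\infty$). *)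

theory Defs
  imports
    "HOL-Algebra.Ideal"
    "HOL-Library.Poly_Mapping"
    "HOL-Library.Extended_Real"
begin

text \<open>The variable \<open>x\<^sub>k\<^sub>,\<^sub>j\<close> is the pair \<open>(k, j)\<close>. A monomial is its exponent vector, so
  \<open>x\<^sub>k\<^sub>,\<^sub>j\<close> divides \<open>u\<close> iff \<open>(k, j) \<in> Poly_Mapping.keys u\<close>. The multiplication of \<open>'a mpoly\<close> is the
  convolution product of \<open>Poly_Mapping\<close>. All rings \<open>R\<^sub>n\<close> live inside this one type and
  are cut out by their carriers; variables with a first index outside \<open>[c]\<close> or with a
  second index \<open>0\<close> occur in none of them.\<close>

type_synonym var = "nat \<times> nat"
type_synonym power_product = "var \<Rightarrow>\<^sub>0 nat"
type_synonym 'a mpoly = "power_product \<Rightarrow>\<^sub>0 'a"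

definition power_products :: "nat \<Rightarrow> nat \<Rightarrow> power_product set" where
  "power_products c n = {u. Poly_Mapping.keys u \<subseteq> {1..c} \<times> {1..n}}"

definition poly_ring :: "nat \<Rightarrow> nat \<Rightarrow> 'a::field mpoly ring" where
  "poly_ring c n =
    \<lparr>carrier = {f. Poly_Mapping.keys f \<subseteq> power_products c n},
     mult = (*), one = 1, zero = 0, add = (+)\<rparr>"

definition mono_poly :: "power_product \<Rightarrow> 'a::field mpoly" where
  "mono_poly u = Poly_Mapping.single u 1"

text \<open>The set of positive integers is \<open>{1..}\<close>; the value at \<open>0\<close> of an element of
  \<open>Inc i\<close> is arbitrary and has no effect on polynomials in any \<open>R\<^sub>n\<close>.\<close>

definition Inc :: "nat \<Rightarrow> (nat \<Rightarrow> nat) set" where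
  "Inc i = {\<pi>. \<pi> ` {1..} \<subseteq> {1..} \<and> strict_mono_on {1..} \<pi> \<and> (\<forall>j\<in>{1..i}. \<pi> j = j)}"

definition Inc_mn :: "nat \<Rightarrow> nat \<Rightarrow> nat \<Rightarrow> (nat \<Rightarrow> nat) set" where
  "Inc_mn i m n = {\<pi> \<in> Inc i. \<pi> m \<le> n}"

definition act_pp :: "(nat \<Rightarrow> nat) \<Rightarrow> power_product \<Rightarrow> power_product" where
  "act_pp \<pi> u = (\<Sum>v\<in>Poly_Mapping.keys u. Poly_Mapping.single (fst v, \<pi> (snd v)) (Poly_Mapping.lookup u v))"

definition act :: "(nat \<Rightarrow> nat) \<Rightarrow> 'a::field mpoly \<Rightarrow> 'a mpoly" where
  "act \<pi> f = (\<Sum>u\<in>Poly_Mapping.keys f. Poly_Mapping.single (act_pp \<pi> u) (Poly_Mapping.lookup f u))"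

definition monomial_ideal :: "nat \<Rightarrow> nat \<Rightarrow> 'a::field mpoly set \<Rightarrow> bool" where
  "monomial_ideal c n J \<longleftrightarrow> ideal J (poly_ring c n) \<and>
    (\<exists>S \<subseteq> power_products c n. J = Idl\<^bsub>poly_ring c n\<^esub> (mono_poly ` S))"

definition Inc_invariant :: "nat \<Rightarrow> (nat \<Rightarrow> 'a::field mpoly set) \<Rightarrow> bool" where
  "Inc_invariant i I \<longleftrightarrow>
    (\<forall>m\<ge>1. \<forall>n\<ge>m. \<forall>f\<in>I m. \<forall>\<pi>\<in>Inc_mn i m n. act \<pi> f \<in> I n)"

definition chain_ind :: "nat \<Rightarrow> nat \<Rightarrow> (nat \<Rightarrow> 'a::field mpoly set) \<Rightarrow> nat" where
  "chain_ind c i I = (LEAST r. r \<ge> 1 \<and>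
    (\<forall>n\<ge>r. I n = Idl\<^bsub>poly_ring c n\<^esub> {act \<pi> f |\<pi> f. f \<in> I r \<and> \<pi> \<in> Inc_mn i r n}))"

definition min_gens :: "nat \<Rightarrow> nat \<Rightarrow> 'a::field mpoly set \<Rightarrow> power_product set" where
  "min_gens c n J = (THE S. S \<subseteq> power_products c n \<and>
     Idl\<^bsub>poly_ring c n\<^esub> (mono_poly ` S) = J \<and>
     (\<forall>T. T \<subset> S \<longrightarrow> Idl\<^bsub>poly_ring c n\<^esub> (mono_poly ` T) \<noteq> J))"

definition min_index :: "power_product \<Rightarrow> nat" where
  "min_index u = Min {j. \<exists>k. (k, j) \<in> Poly_Mapping.keys u}"

definition gens_above :: "nat \<Rightarrow> nat \<Rightarrow> nat \<Rightarrow> 'a::field mpoly set \<Rightarrow> power_product set" where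
  "gens_above c i n J = {u \<in> min_gens c n J. min_index u > i}"

definition covers :: "nat set \<Rightarrow> power_product \<Rightarrow> bool" where
  "covers C u \<longleftrightarrow> (\<exists>k\<in>C. \<exists>j\<ge>1. (k, j) \<in> Poly_Mapping.keys u)"

definition is_cover :: "nat \<Rightarrow> nat \<Rightarrow> nat \<Rightarrow> 'a::field mpoly set \<Rightarrow> nat set \<Rightarrow> bool" where
  "is_cover c i n J C \<longleftrightarrow> C \<subseteq> {1..c} \<and> (\<forall>u\<in>gens_above c i n J. covers C u)"

definition cover_number :: "nat \<Rightarrow> nat \<Rightarrow> nat \<Rightarrow> 'a::field mpoly set \<Rightarrow> enat" where
  "cover_number c i n J =
    (if J = carrier (poly_ring c n) then \<infinity>
     else enat (Min {card C |C. is_cover c i n J C}))"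

definition chain_cover_number :: "nat \<Rightarrow> nat \<Rightarrow> (nat \<Rightarrow> 'a::field mpoly set) \<Rightarrow> enat" where
  "chain_cover_number c i I =
    (THE g. \<forall>n\<ge>chain_ind c i I. cover_number c i n (I n) = g)"

definition prime_height :: "('r, 'm) ring_scheme \<Rightarrow> 'r set \<Rightarrow> enat" where
  "prime_height A P = (SUP l\<in>{l. \<exists>Q :: nat \<Rightarrow> 'r set.
     (\<forall>k\<le>l. primeideal (Q k) A) \<and> (\<forall>k<l. Q k \<subset> Q (Suc k)) \<and> Q l = P}. enat l)"

text \<open>No prime ideal contains the unit ideal, so its codimension is \<open>Inf {} = \<infinity>\<close>.\<close>

definition codim :: "('r, 'm) ring_scheme \<Rightarrow> 'r set \<Rightarrow> enat" where
  "codim A J = (INF P\<in>{P. primeideal P A \<and> J \<subseteq> P}. prime_height A P)"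

end

theory Submission
  imports Defs "HOL-Library.Sublist" "HOL-Library.Product_Lexorder" "HOL-Library.FuncSet"
begin

text \<open>A prime containing a monomial ideal contains a prime generated by variables, and the height of
  such a prime is the number of its variables. Hence \<open>codim I\<^sub>n\<close> is the least size of a set of
  variables meeting the support of every monomial in \<open>I\<^sub>n\<close>, that is \<open>c n\<close> minus the largest size
  \<open>M\<^sub>n\<close> of a set of variables containing no such support. Let \<open>g\<close> be the largest cardinality of a
  complement of an \<open>i\<close>-cover. The rectangles over these complements give \<open>M\<^sub>n \<ge> g (n - i)\<close>, and
  only boundedly many columns of a support-free set have more than \<open>g\<close> elements, so \<open>M\<^sub>n - g n\<close> is
  bounded. It is eventually nondecreasing: duplicating column \<open>p\<close> of a support-free set keeps it
  support-free for all but boundedly many \<open>p\<close>, and for large \<open>n\<close> some other column of an optimal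
  set has at least \<open>g\<close> elements. Higman's lemma makes the index of the chain well-defined.\<close>

section \<open>Independent sets in chains of hypergraphs\<close>

text \<open>No optimal support-free set is ever described. Rectangles give the growth rate only up
  to a constant, and an optimal set may beat them in boundedly many columns. So the proof shows that
  an integer sequence is bounded above and eventually nondecreasing, and its eventual value D is not
  computed. Supports suffice because a prime contains a monomial iff it contains one of its
  variables; only two facts about them are used: increasing maps push supports from level r to level
  n, and each support at level n contains a pushed one. Few columns resist duplication by
  pigeonhole: a support created by duplicating p comes from one of finitely many supports at level
  r, and p cuts its positions 1..r in one of r + 1 places. The index is a least number and the cover
  number of the chain a definite description, so both have meaning only once a stable r exists.
  Heights are found by counting: witnesses of strict inclusions of primes are algebraically
  independent, so a chain of primes has at most c n steps.\<close>

definition embeddings :: "nat \<Rightarrow> nat \<Rightarrow> nat \<Rightarrow> (nat \<Rightarrow> nat) set" where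
  "embeddings i r n = {\<rho>. strict_mono_on {1..r} \<rho> \<and> (\<forall>j\<in>{1..r}. \<rho> j \<in> {1..n}) \<and> (\<forall>j\<in>{1..r}. j \<le> i \<longrightarrow> \<rho> j = j)}"

lemma mono_int_bounded_eventually_const:
  fixes f :: "nat \<Rightarrow> int"
  assumes mono: "\<And>n. n \<ge> N \<Longrightarrow> f n \<le> f (Suc n)" and bound: "\<And>n. n \<ge> N \<Longrightarrow> f n \<le> b"
  shows "\<exists>D N'. \<forall>n\<ge>N'. f n = D"
proof -
  have mono': "f m \<le> f n" if "N \<le> m" "m \<le> n" for m n
    using that(2)
  proof (induction rule: dec_induct)
    case (step k)
    then show ?case using mono[of k] that(1) by simp
  qed simp
  have "\<exists>n\<ge>N. \<forall>m\<ge>N. nat (b - f n) \<le> nat (b - f m)"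
    using ex_has_least_nat[of "\<lambda>n. n \<ge> N" N "\<lambda>n. nat (b - f n)"] by auto
  then obtain n where n: "n \<ge> N" "\<And>m. m \<ge> N \<Longrightarrow> nat (b - f n) \<le> nat (b - f m)" by blast
  have "f m = f n" if "m \<ge> n" for m
    using mono'[of n m] n(2)[of m] bound[of m] bound[of n] n(1) that by linarith
  then show ?thesis by blast
qed

section \<open>Columns of a set of variables, and duplication of one column\<close>

definition column :: "(nat \<times> nat) set \<Rightarrow> nat \<Rightarrow> nat set" where
  "column S j = {k. (k, j) \<in> S}"

lemma card_eq_sum_columns:
  assumes "S \<subseteq> {1..c} \<times> {1..n}"
  shows "card S = (\<Sum>j\<in>{1..n}. card (column S j))"
proof -
  have fin: "finite S" using assms finite_subset by blast
  have "prod.swap ` S = Sigma {1..n} (column S)"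
    using assms by (force simp: column_def image_iff)
  moreover have "card (prod.swap ` S) = card S" by (rule card_image) simp
  moreover have "finite (column S j)" for j
    by (rule finite_subset[of _ "fst ` S"]) (force simp: column_def fin)+
  ultimately show ?thesis by (metis card_SigmaI finite_atLeastAtMost)
qed

text \<open>The passage from n to n + 1 columns. At j = p + 1 the formula reads column p a second
  time, and subtracting one beyond p recovers the old position of a column.\<close>

definition dup_column :: "nat \<Rightarrow> (nat \<times> nat) set \<Rightarrow> (nat \<times> nat) set" where
  "dup_column p S = {(k, j). (k, if j \<le> p then j else j - 1) \<in> S}"

lemma column_dup_column: "column (dup_column p S) j = column S (if j \<le> p then j else j - 1)"
  by (auto simp: column_def dup_column_def)

lemma dup_column_subset:
  assumes "S \<subseteq> {1..c} \<times> {1..n}" "1 \<le> p"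
  shows "dup_column p S \<subseteq> {1..c} \<times> {1..Suc n}"
proof clarify
  fix k j assume "(k, j) \<in> dup_column p S"
  then have "(k, if j \<le> p then j else j - 1) \<in> {1..c} \<times> {1..n}" using assms(1) by (auto simp: dup_column_def)
  then show "k \<in> {1..c} \<and> j \<in> {1..Suc n}" using assms(2) by (auto split: if_splits)
qed

lemma card_dup_column:
  assumes S: "S \<subseteq> {1..c} \<times> {1..n}" and p: "1 \<le> p" "p \<le> n"
  shows "card (dup_column p S) = card S + card (column S p)"
proof -
  let ?s = "\<lambda>j. card (column S j)"
  have "card (dup_column p S) = (\<Sum>j\<in>{1..Suc n}. ?s (if j \<le> p then j else j - 1))"
    using card_eq_sum_columns[OF dup_column_subset[OF S p(1)]] by (simp add: column_dup_column)
  also have "{1..Suc n} = {1..p} \<union> {Suc p..Suc n}" using p by auto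
  also have "(\<Sum>j\<in>\<dots>. ?s (if j \<le> p then j else j - 1)) =
     (\<Sum>j\<in>{1..p}. ?s (if j \<le> p then j else j - 1)) + (\<Sum>j\<in>{Suc p..Suc n}. ?s (if j \<le> p then j else j - 1))"
    by (rule sum.union_disjoint) auto
  also have "(\<Sum>j\<in>{1..p}. ?s (if j \<le> p then j else j - 1)) = (\<Sum>j\<in>{1..p}. ?s j)"
    by (rule sum.cong) auto
  also have "(\<Sum>j\<in>{Suc p..Suc n}. ?s (if j \<le> p then j else j - 1)) = (\<Sum>j\<in>{Suc p..Suc n}. ?s (j - 1))"
    by (rule sum.cong) auto
  also have "(\<Sum>j\<in>{Suc p..Suc n}. ?s (j - 1)) = (\<Sum>j\<in>{p..n}. ?s j)"
    by (simp add: sum.shift_bounds_cl_Suc_ivl del: sum.cl_ivl_Suc)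
  also have "\<dots> = ?s p + (\<Sum>j\<in>{Suc p..n}. ?s j)" using p by (simp add: sum.atLeast_Suc_atMost)
  also have "(\<Sum>j\<in>{1..p}. ?s j) + (?s p + (\<Sum>j\<in>{Suc p..n}. ?s j)) = (\<Sum>j\<in>{1..p} \<union> {Suc p..n}. ?s j) + ?s p"
    by (subst sum.union_disjoint) auto
  also have "{1..p} \<union> {Suc p..n} = {1..n}" using p by auto
  finally show ?thesis using card_eq_sum_columns[OF S] by simp
qed

text \<open>\<open>H n\<close> will consist of the supports of all monomials at level n, multiples
  included, which is why \<open>pull\<close> asks only for an inclusion. The last assumption
  excludes the unit ideal.\<close>

locale hypergraph_chain =
  fixes c i r :: nat and H :: "nat \<Rightarrow> (nat \<times> nat) set set"
  assumes edges: "\<And>n F. r \<le> n \<Longrightarrow> F \<in> H n \<Longrightarrow> F \<subseteq> {1..c} \<times> {1..n}"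
    and push: "\<And>n E \<rho>. r \<le> n \<Longrightarrow> E \<in> H r \<Longrightarrow> \<rho> \<in> embeddings i r n \<Longrightarrow> map_prod id \<rho> ` E \<in> H n"
    and pull: "\<And>n F. r \<le> n \<Longrightarrow> F \<in> H n \<Longrightarrow> \<exists>E\<in>H r. \<exists>\<rho>\<in>embeddings i r n. map_prod id \<rho> ` E \<subseteq> F"
    and nonempty: "{} \<notin> H r"
begin

definition independent_sets :: "nat \<Rightarrow> (nat \<times> nat) set set" where
  "independent_sets n = {S. S \<subseteq> {1..c} \<times> {1..n} \<and> (\<forall>F\<in>H n. \<not> F \<subseteq> S)}"

lemma finite_independent_sets: "finite (independent_sets n)"
  by (rule finite_subset[of _ "Pow ({1..c} \<times> {1..n})"]) (auto simp: independent_sets_def)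

text \<open>Pigeonhole. For a bad column p, some edge E of level r embeds into the duplicated set,
  and p cuts the positions 1..r of this embedding after some place a. Two bad columns never share a
  pair (E, a).\<close>

lemma bad_columns:
  assumes n: "r \<le> n" and S: "S \<in> independent_sets n"
  defines "B \<equiv> {p. i < p \<and> p \<le> n \<and> dup_column p S \<notin> independent_sets (Suc n)}"
  shows "finite B \<and> card B \<le> card (H r \<times> {0..r})"
proof -
  have Ssub: "S \<subseteq> {1..c} \<times> {1..n}" and Sind: "\<And>F. F \<in> H n \<Longrightarrow> \<not> F \<subseteq> S"
    using S by (auto simp: independent_sets_def)
  define Q where "Q p q \<longleftrightarrow> (\<exists>\<rho>. fst q \<in> H r \<and> \<rho> \<in> embeddings i r (Suc n) \<and>
     map_prod id \<rho> ` fst q \<subseteq> dup_column p S \<and> snd q \<le> r \<and> (\<forall>j\<in>{1..r}. \<rho> j \<le> p \<longleftrightarrow> j \<le> snd q))" for p q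
  have ex: "\<exists>q. Q p q" if "p \<in> B" for p
  proof -
    have p: "i < p" "p \<le> n" and nd: "dup_column p S \<notin> independent_sets (Suc n)" using that by (auto simp: B_def)
    then obtain F where F: "F \<in> H (Suc n)" "F \<subseteq> dup_column p S"
      using dup_column_subset[OF Ssub, of p] by (auto simp: independent_sets_def)
    obtain E \<rho> where E: "E \<in> H r" "\<rho> \<in> embeddings i r (Suc n)" "map_prod id \<rho> ` E \<subseteq> F"
      using pull[OF _ F(1)] n by auto
    \<comment> \<open>The inserted 0 keeps the set nonempty; a = 0 means that all of {1..r} is sent
      beyond p.\<close>
    define X where "X = insert 0 {j\<in>{1..r}. \<rho> j \<le> p}"
    define a where "a = Max X"
    have X: "finite X" "X \<noteq> {}" by (auto simp: X_def)
    have aX: "a \<in> X" using Max_in X a_def by blast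
    have mono: "strict_mono_on {1..r} \<rho>" using E(2) by (simp add: embeddings_def)
    have "\<rho> j \<le> p \<longleftrightarrow> j \<le> a" if j: "j \<in> {1..r}" for j
    proof
      assume "\<rho> j \<le> p" then have "j \<in> X" using j by (simp add: X_def)
      then show "j \<le> a" using X a_def by simp
    next
      assume ja: "j \<le> a"
      then have a: "a \<in> {1..r}" "\<rho> a \<le> p" using aX j by (auto simp: X_def)
      have "\<rho> j \<le> \<rho> a" using mono ja a(1) j
        by (metis le_eq_less_or_eq strict_mono_onD)
      then show "\<rho> j \<le> p" using a by simp
    qed
    moreover have "a \<le> r" using aX by (auto simp: X_def)
    ultimately have "Q p (E, a)" unfolding Q_def fst_conv snd_conv using E F(2) by blast
    then show ?thesis by blast
  qed
  \<comment> \<open>If \<open>p < p'\<close> had the same witness \<open>(E, a)\<close>, gluing the first embedding on \<open>{1..a}\<close> to the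
    second one beyond \<open>a\<close> would embed \<open>E\<close> into \<open>S\<close> itself.\<close>
  have no_share: False if "Q p q" "Q p' q" "p < p'" "p \<in> B" for p p' q
  proof -
    obtain E a where q: "q = (E, a)" by (cases q)
    obtain \<rho> where \<rho>: "E \<in> H r" "\<rho> \<in> embeddings i r (Suc n)" "map_prod id \<rho> ` E \<subseteq> dup_column p S" "a \<le> r"
      "\<And>j. j \<in> {1..r} \<Longrightarrow> \<rho> j \<le> p \<longleftrightarrow> j \<le> a"
      using \<open>Q p q\<close> by (auto simp: Q_def q)
    obtain \<rho>' where \<rho>': "\<rho>' \<in> embeddings i r (Suc n)" "map_prod id \<rho>' ` E \<subseteq> dup_column p' S"
      "\<And>j. j \<in> {1..r} \<Longrightarrow> \<rho>' j \<le> p' \<longleftrightarrow> j \<le> a"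
      using \<open>Q p' q\<close> by (auto simp: Q_def q)
    have p: "i < p" "p \<le> n" using \<open>p \<in> B\<close> by (auto simp: B_def)
    have m: "strict_mono_on {1..r} \<rho>" "strict_mono_on {1..r} \<rho>'"
      and r: "\<And>j. j \<in> {1..r} \<Longrightarrow> 1 \<le> \<rho> j \<and> \<rho> j \<le> Suc n" "\<And>j. j \<in> {1..r} \<Longrightarrow> 1 \<le> \<rho>' j \<and> \<rho>' j \<le> Suc n"
      and fix_i: "\<And>j. j \<in> {1..r} \<Longrightarrow> j \<le> i \<Longrightarrow> \<rho> j = j"
      using \<rho>(2) \<rho>'(1) by (auto simp: embeddings_def)
    \<comment> \<open>This undoes both duplications: values up to p already point into S, values
      beyond p' are one too large. At the seam \<rho> x \<le> p < p' \<le> \<rho>' y - 1, so the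
      glued map stays strictly increasing. Embeddings are constrained on {1..r} only, so nothing
      else has to be glued.\<close>
    define \<sigma> where "\<sigma> j = (if j \<le> a then \<rho> j else \<rho>' j - 1)" for j
    have "\<sigma> \<in> embeddings i r n"
      unfolding embeddings_def mem_Collect_eq
    proof (intro conjI)
      show "strict_mono_on {1..r} \<sigma>"
      proof (rule strict_mono_onI)
        fix x y assume xy: "x \<in> {1..r}" "y \<in> {1..r}" "x < y"
        show "\<sigma> x < \<sigma> y"
          using strict_mono_onD[OF m(1) xy] strict_mono_onD[OF m(2) xy] \<rho>(5)[OF xy(1)] \<rho>(5)[OF xy(2)]
            \<rho>'(3)[OF xy(1)] \<rho>'(3)[OF xy(2)] xy(3) \<open>p < p'\<close> by (auto simp: \<sigma>_def)
      qed
      show "\<forall>j\<in>{1..r}. \<sigma> j \<in> {1..n}"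
      proof
        fix x assume x: "x \<in> {1..r}"
        show "\<sigma> x \<in> {1..n}"
          using \<rho>(5)[OF x] \<rho>'(3)[OF x] r(1)[OF x] r(2)[OF x] p \<open>p < p'\<close> by (auto simp: \<sigma>_def)
      qed
      \<comment> \<open>Here i < p enters: a position j \<le> i has \<rho> j = j \<le> p, so it lies
        left of the cut, where nothing is shifted.\<close>
      show "\<forall>j\<in>{1..r}. j \<le> i \<longrightarrow> \<sigma> j = j"
        using \<rho>(5) p fix_i by (fastforce simp: \<sigma>_def)
    qed
    from push[OF n \<rho>(1) this] have "map_prod id \<sigma> ` E \<in> H n" .
    moreover have "map_prod id \<sigma> ` E \<subseteq> S"
    proof (rule image_subsetI)
      fix e assume "e \<in> E"
      then obtain k j where e: "e = (k, j)" and kj: "(k, j) \<in> E" by (cases e) auto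
      then have j: "j \<in> {1..r}" using edges[OF order_refl \<rho>(1)] by auto
      have 1: "(k, \<rho> j) \<in> dup_column p S" using \<rho>(3) kj by force
      have 2: "(k, \<rho>' j) \<in> dup_column p' S" using \<rho>'(2) kj by force
      show "map_prod id \<sigma> e \<in> S"
        using 1 2 \<rho>(5)[OF j] \<rho>'(3)[OF j] by (auto simp: e \<sigma>_def dup_column_def split: if_splits)
    qed
    ultimately show False using Sind by blast
  qed
  define q where "q p = (SOME q. Q p q)" for p
  have q: "Q p (q p)" if "p \<in> B" for p using someI_ex[OF ex[OF that]] by (simp add: q_def)
  have "inj_on q B"
    by (rule inj_onI) (metis q no_share linorder_neqE_nat)
  moreover have "q ` B \<subseteq> H r \<times> {0..r}"
  proof (rule image_subsetI)
    fix p assume "p \<in> B"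
    from q[OF this] show "q p \<in> H r \<times> {0..r}" by (auto simp: Q_def mem_Times_iff)
  qed
  moreover have "finite (H r)"
    by (rule finite_subset[of _ "Pow ({1..c} \<times> {1..r})"]) (use edges in auto)
  moreover have "finite B" by (auto simp: B_def)
  ultimately show ?thesis by (meson card_inj_on_le finite_SigmaI finite_atLeastAtMost)
qed

text \<open>If more than r columns beyond i were equal to B, then position j could be sent to the
  j-th of them for i < j \<le> r, with the positions up to i fixed. The edge E uses only positions
  beyond i and rows in B, so its image would lie inside S.\<close>

lemma few_columns_above:
  assumes n: "r \<le> n" and S: "S \<in> independent_sets n"
    and B: "E \<in> H r" "E \<subseteq> B \<times> {i<..}"
  shows "card {j. i < j \<and> j \<le> n \<and> column S j = B} \<le> r"
proof (rule ccontr)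
  define X where "X = {j. i < j \<and> j \<le> n \<and> column S j = B}"
  assume "\<not> ?thesis"
  then have card: "card X > r" by (simp add: X_def)
  have fin: "finite X" by (simp add: X_def)
  define xs where "xs = sorted_list_of_set X"
  have xs: "length xs = card X" "set xs = X" "sorted_wrt (<) xs"
    using fin strict_sorted_list_of_set[of X] by (auto simp: xs_def)
  define \<rho> where "\<rho> j = (if j \<le> i then j else xs ! (j - 1))" for j
  have gt: "i < xs ! k \<and> xs ! k \<le> n \<and> column S (xs ! k) = B" if "k < r" for k
  proof -
    have "xs ! k \<in> X" using that card xs(1,2) nth_mem[of k xs] by auto
    then show ?thesis by (simp add: X_def)
  qed
  have "\<rho> \<in> embeddings i r n"
    unfolding embeddings_def mem_Collect_eq
  proof (intro conjI)
    show "strict_mono_on {1..r} \<rho>"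
    proof (rule strict_mono_onI)
      fix x y assume xy: "x \<in> {1..r}" "y \<in> {1..r}" "x < y"
      have "xs ! (x - 1) < xs ! (y - 1)"
        using xs(3) sorted_wrt_nth_less[of "(<)" xs "x - 1" "y - 1"] xy card xs(1) by auto
      moreover have "i < xs ! (y - 1)" using gt[of "y - 1"] xy by auto
      ultimately show "\<rho> x < \<rho> y" using xy by (auto simp: \<rho>_def)
    qed
    show "\<forall>j\<in>{1..r}. \<rho> j \<in> {1..n}"
    proof
      fix x assume x: "x \<in> {1..r}"
      then have "x - 1 < r" by auto
      from gt[OF this] x n show "\<rho> x \<in> {1..n}" by (auto simp: \<rho>_def)
    qed
    show "\<forall>j\<in>{1..r}. j \<le> i \<longrightarrow> \<rho> j = j" by (simp add: \<rho>_def)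
  qed
  from push[OF n B(1) this] have "map_prod id \<rho> ` E \<in> H n" .
  moreover have "map_prod id \<rho> ` E \<subseteq> S"
  proof (rule image_subsetI)
    fix e assume "e \<in> E"
    then obtain k j where e: "e = (k, j)" and kj: "(k, j) \<in> E" by (cases e) auto
    then have j: "j \<in> {1..r}" "k \<in> B" "i < j" using edges[OF order_refl B(1)] B(2) by auto
    then have "j - 1 < r" by auto
    from gt[OF this] j show "map_prod id \<rho> e \<in> S" by (auto simp: e \<rho>_def column_def)
  qed
  ultimately show False using S by (auto simp: independent_sets_def)
qed

text \<open>An embedding fixes the positions up to i, so an edge whose image lies beyond i lies
  beyond i itself; rows never move. This makes the cover number independent of the level.\<close>

lemma rectangle_edge_iff:
  assumes "r \<le> n"
  shows "(\<exists>F\<in>H n. F \<subseteq> A \<times> {i<..}) \<longleftrightarrow> (\<exists>F\<in>H r. F \<subseteq> A \<times> {i<..})"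
proof
  assume "\<exists>F\<in>H n. F \<subseteq> A \<times> {i<..}"
  then obtain F where F: "F \<in> H n" "F \<subseteq> A \<times> {i<..}" by blast
  obtain E \<rho> where E: "E \<in> H r" "\<rho> \<in> embeddings i r n" "map_prod id \<rho> ` E \<subseteq> F"
    using pull[OF assms F(1)] by metis
  have "E \<subseteq> A \<times> {i<..}"
  proof clarify
    fix k j assume kj: "(k, j) \<in> E"
    then have j: "j \<in> {1..r}" using edges[OF order_refl E(1)] by auto
    have "(k, \<rho> j) \<in> A \<times> {i<..}" using kj E(3) F(2) by force
    moreover have "\<rho> j = j" if "j \<le> i" using E(2) j that by (auto simp: embeddings_def)
    ultimately show "k \<in> A \<and> j \<in> {i<..}" by (cases "j \<le> i") auto
  qed
  then show "\<exists>F\<in>H r. F \<subseteq> A \<times> {i<..}" using E(1) by blast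
next
  assume "\<exists>F\<in>H r. F \<subseteq> A \<times> {i<..}"
  moreover have "id \<in> embeddings i r n" using assms by (auto simp: embeddings_def strict_mono_on_def)
  ultimately show "\<exists>F\<in>H n. F \<subseteq> A \<times> {i<..}" using push[OF assms] by (metis image_ident map_prod.id map_prod_ident id_apply image_id)
qed

definition max_independent :: "nat \<Rightarrow> nat" where
  "max_independent n = Max (card ` independent_sets n)"

lemma max_independent_ge: "S \<in> independent_sets n \<Longrightarrow> card S \<le> max_independent n"
  using finite_independent_sets by (simp add: max_independent_def)

text \<open>A will be the complement of a smallest i-cover, so card A is the expected growth rate,
  called g in the overview; \<open>A_max\<close> expresses that no smaller cover exists.\<close>

context
  fixes A :: "nat set"
  assumes A: "A \<subseteq> {1..c}" "\<And>F. F \<in> H r \<Longrightarrow> \<not> F \<subseteq> A \<times> {i<..}"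
    and A_max: "\<And>B. B \<subseteq> {1..c} \<Longrightarrow> card A < card B \<Longrightarrow> \<exists>F\<in>H r. F \<subseteq> B \<times> {i<..}"
begin

lemma rectangle_independent:
  assumes "r \<le> n"
  shows "A \<times> {i<..n} \<in> independent_sets n"
  using rectangle_edge_iff[OF assms, of A] A unfolding independent_sets_def by fastforce

lemma max_independent_ge_linear: "r \<le> n \<Longrightarrow> card A * (n - i) \<le> max_independent n"
  using max_independent_ge[OF rectangle_independent, of n] by (simp add: card_cartesian_product)

lemma max_independent_attained:
  assumes "r \<le> n"
  obtains S where "S \<in> independent_sets n" "card S = max_independent n"
proof -
  have "card ` independent_sets n \<noteq> {}" using rectangle_independent[OF assms] by blast
  then have "max_independent n \<in> card ` independent_sets n"
    unfolding max_independent_def using finite_independent_sets by (intro Max_in) auto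
  then show ?thesis using that by auto
qed

text \<open>There are at most 2 ^ c row sets larger than A. For each of them some edge lies in the
  rectangle over it, so \<open>few_columns_above\<close> lets it occur as a column at most r
  times.\<close>

lemma few_big_columns:
  assumes n: "r \<le> n" and S: "S \<in> independent_sets n"
  shows "card {j. i < j \<and> j \<le> n \<and> card A < card (column S j)} \<le> 2 ^ c * r"
proof -
  let ?X = "\<lambda>B. {j. i < j \<and> j \<le> n \<and> column S j = B}"
  let ?P = "{B. B \<subseteq> {1..c} \<and> card A < card B}"
  have sub: "column S j \<subseteq> {1..c}" for j using S by (auto simp: independent_sets_def column_def)
  have finP: "finite ?P" by (rule finite_subset[of _ "Pow {1..c}"]) auto
  have "{j. i < j \<and> j \<le> n \<and> card A < card (column S j)} \<subseteq> (\<Union>B\<in>?P. ?X B)" using sub by auto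
  then have "card {j. i < j \<and> j \<le> n \<and> card A < card (column S j)} \<le> card (\<Union>B\<in>?P. ?X B)"
    by (intro card_mono) (use finP in auto)
  also have "\<dots> \<le> (\<Sum>B\<in>?P. card (?X B))" by (rule card_UN_le[OF finP])
  also have "\<dots> \<le> (\<Sum>B\<in>?P. r)"
    by (intro sum_mono) (use few_columns_above[OF n S] A_max in blast)
  also have "\<dots> = card ?P * r" by simp
  also have "card ?P \<le> card (Pow {1..c})" by (intro card_mono) auto
  also have "\<dots> = 2 ^ c" by (simp add: card_Pow)
  finally show ?thesis by simp
qed

lemma card_independent_le:
  assumes n: "r \<le> n" and S: "S \<in> independent_sets n"
  defines "s \<equiv> card {j. i < j \<and> j \<le> n \<and> card (column S j) < card A}"
  shows "card S + s \<le> c * i + c * (2 ^ c * r) + card A * n"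
proof -
  have Ssub: "S \<subseteq> {1..c} \<times> {1..n}" using S by (auto simp: independent_sets_def)
  let ?s = "\<lambda>j. card (column S j)"
  let ?small = "{j. i < j \<and> j \<le> n \<and> ?s j < card A}"
  let ?big = "{j. i < j \<and> j \<le> n \<and> card A < ?s j}"
  let ?ch = "\<lambda>X j. if j \<in> X then (1::nat) else 0"
  have le_c: "?s j \<le> c" for j
    using card_mono[of "{1..c}" "column S j"] Ssub by (auto simp: column_def)
  have count: "(\<Sum>j\<in>{1..n}. ?ch X j) \<le> card X" "X \<subseteq> {1..n} \<Longrightarrow> (\<Sum>j\<in>{1..n}. ?ch X j) = card X"
    if "finite X" for X
    using that by (auto simp: sum.If_cases Int_absorb1 intro!: card_mono)
  have "card S + s = (\<Sum>j\<in>{1..n}. ?s j + ?ch ?small j)"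
    unfolding s_def card_eq_sum_columns[OF Ssub] sum.distrib by (subst count(2)) auto
  also have "\<dots> \<le> (\<Sum>j\<in>{1..n}. c * ?ch {1..i} j + c * ?ch ?big j + card A)"
  proof (rule sum_mono)
    fix j assume "j \<in> {1..n}"
    then show "?s j + ?ch ?small j \<le> c * ?ch {1..i} j + c * ?ch ?big j + card A"
      using le_c[of j] by (auto simp: not_less)
  qed
  also have "\<dots> = c * (\<Sum>j\<in>{1..n}. ?ch {1..i} j) + c * (\<Sum>j\<in>{1..n}. ?ch ?big j) + card A * n"
    by (simp add: sum.distrib sum_distrib_left)
  also have "\<dots> \<le> c * i + c * (2 ^ c * r) + card A * n"
    using count(1)[of "{1..i}"] count(1)[of ?big] few_big_columns[OF n S]
    by (intro add_mono mult_le_mono order_refl) auto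
  finally show ?thesis .
qed

text \<open>The threshold leaves room in {i<..n} for a column that is neither small nor bad;
  duplicating it gains at least card A. One term c * i comes from
  \<open>card_independent_le\<close>, the other from replacing n - i by n in the lower bound, as
  card A \<le> c.\<close>

lemma max_independent_Suc:
  assumes n: "r \<le> n" and large: "2 * (c * i) + c * (2 ^ c * r) + card (H r \<times> {0..r}) + i < n"
  shows "max_independent n + card A \<le> max_independent (Suc n)"
proof -
  obtain S where S: "S \<in> independent_sets n" "card S = max_independent n"
    using max_independent_attained[OF n] .
  have Ssub: "S \<subseteq> {1..c} \<times> {1..n}" using S by (auto simp: independent_sets_def)
  define small where "small = {j. i < j \<and> j \<le> n \<and> card (column S j) < card A}"
  define bad where "bad = {p. i < p \<and> p \<le> n \<and> dup_column p S \<notin> independent_sets (Suc n)}"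
  have "card A * n \<le> card A * (n - i) + card A * i"
    by (metis add.commute distrib_left le_add_diff_inverse2 mult_le_mono2 nat_le_linear diff_is_0_eq' add_0 le_refl)
  also have "\<dots> \<le> card S + c * i"
    using max_independent_ge_linear[OF n] card_mono[OF _ A(1)] S(2) by (intro add_mono mult_le_mono1) auto
  finally have "card small \<le> 2 * (c * i) + c * (2 ^ c * r)"
    using card_independent_le[OF n S(1)] unfolding small_def by linarith
  moreover have "card bad \<le> card (H r \<times> {0..r})"
    using bad_columns[OF n S(1)] unfolding bad_def by blast
  ultimately have "card (small \<union> bad) < card {i<..n}"
    using card_Un_le[of small bad] large by simp
  then have "\<not> {i<..n} \<subseteq> small \<union> bad"
    using card_mono[of "small \<union> bad" "{i<..n}"] by (auto simp: small_def bad_def)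
  then obtain p where "p \<in> {i<..n} - (small \<union> bad)" by blast
  then have p: "i < p" "p \<le> n" "p \<notin> small" "p \<notin> bad" by auto
  have "dup_column p S \<in> independent_sets (Suc n)" "card A \<le> card (column S p)"
    using p by (auto simp: small_def bad_def)
  then show ?thesis
    using max_independent_ge card_dup_column[OF Ssub, of p] p S(2) by fastforce
qed

theorem max_independent_eventually_linear:
  "\<exists>D N. \<forall>n\<ge>N. int (max_independent n) = int (card A) * int n + D"
proof -
  define N where "N = r + (2 * (c * i) + c * (2 ^ c * r) + card (H r \<times> {0..r}) + i) + 1"
  define f where "f n = int (max_independent n) - int (card A) * int n" for n
  have "f n \<le> f (Suc n)" if "n \<ge> N" for n
    using max_independent_Suc[of n] that by (simp add: f_def N_def algebra_simps)
  moreover have "f n \<le> int (c * i + c * (2 ^ c * r))" if "n \<ge> N" for n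
  proof -
    have n: "r \<le> n" using that by (simp add: N_def)
    obtain S where S: "S \<in> independent_sets n" "card S = max_independent n"
      using max_independent_attained[OF n] .
    have "max_independent n \<le> c * i + c * (2 ^ c * r) + card A * n"
      using card_independent_le[OF n S(1)] S(2) by simp
    then have "int (max_independent n) \<le> int (c * i + c * (2 ^ c * r) + card A * n)" by (rule of_nat_mono)
    then show ?thesis by (simp add: f_def)
  qed
  ultimately obtain D N' where "\<And>n. n \<ge> N' \<Longrightarrow> f n = D"
    using mono_int_bounded_eventually_const[of N f] by metis
  then show ?thesis unfolding f_def by (metis diff_eq_eq add.commute)
qed

end

end

section \<open>Well-quasi-orders and Higman's lemma\<close>

definition wqo_on :: "('a \<Rightarrow> 'a \<Rightarrow> bool) \<Rightarrow> 'a set \<Rightarrow> bool" where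
  "wqo_on P A \<longleftrightarrow> reflp_on A P \<and> transp_on A P \<and> (\<forall>f :: nat \<Rightarrow> 'a. range f \<subseteq> A \<longrightarrow> (\<exists>i j. i < j \<and> P (f i) (f j)))"

text \<open>The indices with no later term above theirs are finite in number, since otherwise they
  would enumerate a sequence without a good pair. Past the last of them every term has a larger
  successor, and transitivity does the rest.\<close>

lemma wqo_on_subseq:
  assumes wqo: "wqo_on P A" and f: "\<And>n. f n \<in> A"
  shows "\<exists>\<phi> :: nat \<Rightarrow> nat. strict_mono \<phi> \<and> (\<forall>i j. i < j \<longrightarrow> P (f (\<phi> i)) (f (\<phi> j)))"
proof -
  define T where "T = {i. \<forall>j>i. \<not> P (f i) (f j)}"
  have "finite T"
  proof (rule ccontr)
    assume inf: "infinite T"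
    have "range (\<lambda>n. f (enumerate T n)) \<subseteq> A" using f by auto
    then obtain i j where "i < j" "P (f (enumerate T i)) (f (enumerate T j))"
      using wqo unfolding wqo_on_def by blast
    then show False
      using enumerate_in_set[OF inf, of i] enumerate_mono[OF \<open>i < j\<close> inf] by (auto simp: T_def)
  qed
  then obtain N where N: "\<And>i. i \<in> T \<Longrightarrow> i < N"
    by (meson finite_nat_set_iff_bounded)
  have "\<exists>j>i. P (f i) (f j)" if "i \<ge> N" for i
    using N[of i] that by (auto simp: T_def)
  then have step: "\<exists>j>i. P (f i) (f j) \<and> N \<le> j" if "i \<ge> N" for i
    using that by (meson less_imp_le order_trans)
  obtain \<phi> where \<phi>: "\<And>n. N \<le> \<phi> n" "\<And>n. \<phi> n < \<phi> (Suc n) \<and> P (f (\<phi> n)) (f (\<phi> (Suc n)))"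
  proof -
    have "\<exists>\<phi>. \<forall>n. N \<le> \<phi> n \<and> (\<phi> n < \<phi> (Suc n) \<and> P (f (\<phi> n)) (f (\<phi> (Suc n))))"
      by (rule dependent_nat_choice) (use step in auto)
    then show ?thesis using that by blast
  qed
  have "P (f (\<phi> i)) (f (\<phi> j))" if "i < j" for i j
    using that
  proof (induction rule: strict_inc_induct[consumes 1])
    case (base i)
    then show ?case using \<phi>(2) by simp
  next
    case (step i)
    have "transp_on A P" using wqo by (simp add: wqo_on_def)
    from transp_onD[OF this f f f] show ?case using \<phi>(2) step.IH by blast
  qed
  moreover have "strict_mono \<phi>" using \<phi>(2) by (simp add: strict_mono_Suc_iff)
  ultimately show ?thesis by blast
qed

text \<open>Pass to a subsequence increasing for P and find a good pair for Q inside it. Iterated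
  over coordinates, this yields Dickson's lemma in \<open>wqo_on_pointwise_le\<close>.\<close>

lemma wqo_on_conj:
  fixes A :: "'a set"
  assumes P: "wqo_on P A" and Q: "wqo_on Q A"
  shows "wqo_on (\<lambda>x y. P x y \<and> Q x y) A"
proof -
  have "\<exists>i j. i < j \<and> P (f i) (f j) \<and> Q (f i) (f j)" if f: "range f \<subseteq> A" for f :: "nat \<Rightarrow> 'a"
  proof -
    obtain \<phi> :: "nat \<Rightarrow> nat" where \<phi>: "strict_mono \<phi>" "\<And>i j. i < j \<Longrightarrow> P (f (\<phi> i)) (f (\<phi> j))"
      using wqo_on_subseq[OF P, of f] f by blast
    have "range (f \<circ> \<phi>) \<subseteq> A" using f by auto
    then have "\<exists>i j. i < j \<and> Q ((f \<circ> \<phi>) i) ((f \<circ> \<phi>) j)"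
      using Q unfolding wqo_on_def by blast
    then obtain i j where "i < j" "Q (f (\<phi> i)) (f (\<phi> j))" by auto
    then show ?thesis using \<phi> strict_monoD by blast
  qed
  moreover have "reflp_on A (\<lambda>x y. P x y \<and> Q x y)"
    using P Q unfolding wqo_on_def reflp_on_def by blast
  moreover have "transp_on A (\<lambda>x y. P x y \<and> Q x y)"
  proof (rule transp_onI)
    have PQ: "transp_on A P" "transp_on A Q" using P Q by (simp_all add: wqo_on_def)
    fix x y z assume A: "x \<in> A" "y \<in> A" "z \<in> A" and "P x y \<and> Q x y" "P y z \<and> Q y z"
    then show "P x z \<and> Q x z" using transp_onD[OF PQ(1) A] transp_onD[OF PQ(2) A] by blast
  qed
  ultimately show ?thesis unfolding wqo_on_def by blast
qed

lemma wqo_on_pullback_nat: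
  fixes A :: "'a set" and g :: "'a \<Rightarrow> nat"
  shows "wqo_on (\<lambda>x y. g x \<le> g y) A"
proof -
  have "\<exists>i j. i < j \<and> g (f i) \<le> g (f j)" for f :: "nat \<Rightarrow> 'a"
  proof -
    obtain i where "\<And>y. g (f i) \<le> g (f y)"
      using ex_has_least_nat[of "\<lambda>_. True" 0 "\<lambda>i. g (f i)"] by auto
    then show ?thesis by (meson lessI)
  qed
  then show ?thesis by (auto simp: wqo_on_def reflp_on_def transp_on_def)
qed

lemma wqo_on_pullback_finite:
  fixes A :: "'a set"
  assumes "finite (g ` A)"
  shows "wqo_on (\<lambda>x y. g x = g y) A"
proof -
  have "\<exists>i j. i < j \<and> g (f i) = g (f j)" if f: "range f \<subseteq> A" for f :: "nat \<Rightarrow> 'a"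
  proof (rule ccontr)
    assume "\<not> ?thesis"
    then have "inj (g \<circ> f)" by (auto intro!: injI) (metis linorder_neqE_nat)
    moreover have "range (g \<circ> f) \<subseteq> g ` A" using f by auto
    ultimately show False using assms finite_subset finite_imageD infinite_UNIV_nat by metis
  qed
  then show ?thesis by (auto simp: wqo_on_def reflp_on_def transp_on_def)
qed

lemma wqo_on_pointwise_le:
  assumes "finite K"
  shows "wqo_on (\<lambda>x y. \<forall>k\<in>K. (x k :: nat) \<le> y k) A"
  using assms
proof (induction K)
  case empty
  show ?case by (auto simp: wqo_on_def reflp_on_def transp_on_def)
next
  case (insert k K)
  have "wqo_on (\<lambda>x y. x k \<le> y k \<and> (\<forall>k\<in>K. x k \<le> y k)) A"
    by (rule wqo_on_conj[OF wqo_on_pullback_nat insert.IH])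
  then show ?case by simp
qed

text \<open>The minimal bad sequence argument of Nash-Williams.\<close>

theorem wqo_on_list_emb:
  fixes A :: "'a set"
  assumes wqo: "wqo_on P A"
  shows "wqo_on (list_emb P) (lists A)"
proof -
  have refl: "P x x" if "x \<in> A" for x using wqo that by (auto simp: wqo_on_def reflp_on_def)
  have trans: "transp_on A P" using wqo by (simp add: wqo_on_def)
  define bad where "bad f \<longleftrightarrow> range f \<subseteq> lists A \<and> (\<forall>i j. i < j \<longrightarrow> \<not> list_emb P (f i) (f j))" for f :: "nat \<Rightarrow> 'a list"
  have "\<not> bad f" for f
  proof
    assume "bad f"
    define minimal where "minimal n g \<longleftrightarrow> (\<forall>h. bad h \<and> (\<forall>i<n. h i = g i) \<longrightarrow> length (g n) \<le> length (h n))"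
      for n and g :: "nat \<Rightarrow> 'a list"
    \<comment> \<open>Each step keeps the first n entries and makes entry n as short as possible
      among the bad sequences with this prefix. The diagonal m is bad, because any two of its
      entries occur together in some \<open>G n\<close>, and it is minimal at every place.\<close>
    have "\<exists>G. \<forall>n. (bad (G n) \<and> (\<forall>k<n. minimal k (G n))) \<and> (\<forall>k<n. G (Suc n) k = G n k)"
    proof (rule dependent_nat_choice)
      show "\<exists>g. bad g \<and> (\<forall>k<0. minimal k g)" using \<open>bad f\<close> by auto
    next
      fix g n assume g: "bad g \<and> (\<forall>k<n. minimal k g)"
      define Q where "Q h \<longleftrightarrow> bad h \<and> (\<forall>i<n. h i = g i)" for h
      obtain h where h: "Q h" "\<And>h'. Q h' \<Longrightarrow> length (h n) \<le> length (h' n)"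
        using ex_has_least_nat[of Q g "\<lambda>h. length (h n)"] g by (auto simp: Q_def)
      have "minimal k h" if "k < Suc n" for k
      proof (cases "k = n")
        case True
        then show ?thesis using h by (auto simp: minimal_def Q_def)
      next
        case False
        with that have k: "k < n" by simp
        then have "minimal k g" using g by blast
        then show ?thesis using h(1) k by (auto simp: minimal_def Q_def)
      qed
      then show "\<exists>h. (bad h \<and> (\<forall>k<Suc n. minimal k h)) \<and> (\<forall>k<n. h k = g k)"
        using h(1) by (auto simp: Q_def)
    qed
    then obtain G where G: "\<And>n. bad (G n)" "\<And>n k. k < n \<Longrightarrow> minimal k (G n)"
      "\<And>n k. k < n \<Longrightarrow> G (Suc n) k = G n k" by metis
    have stable: "G n k = G m k" if "k < m" "m \<le> n" for k m n
      using that(2) by (induction rule: dec_induct) (use that(1) G(3) in auto)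
    define m where "m n = G (Suc n) n" for n
    have mG: "m k = G n k" if "k < n" for k n
      using stable[of k "Suc k" n] that by (simp add: m_def)
    have bad_m: "bad m"
      unfolding bad_def
    proof (intro conjI allI impI subsetI)
      fix x assume "x \<in> range m"
      then show "x \<in> lists A" using G(1) by (auto simp: m_def bad_def)
    next
      fix i j :: nat assume "i < j"
      then show "\<not> list_emb P (m i) (m j)" using mG[of i "Suc j"] mG[of j "Suc j"] G(1)[of "Suc j"]
        by (simp add: bad_def)
    qed
    have min_m: "length (m n) \<le> length (h n)" if "bad h" "\<And>i. i < n \<Longrightarrow> h i = m i" for h n
      using G(2)[of n "Suc n"] that mG[of _ "Suc n"] by (auto simp: minimal_def)
    have ne: "m n \<noteq> []" for n
      using bad_m unfolding bad_def by (metis lessI list_emb_Nil)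
    have mA: "hd (m n) \<in> A" "tl (m n) \<in> lists A" for n
    proof -
      have "m n \<in> lists A" using bad_m by (auto simp: bad_def)
      then show "hd (m n) \<in> A" "tl (m n) \<in> lists A" using ne[of n] by (cases "m n"; auto)+
    qed
    obtain \<phi> :: "nat \<Rightarrow> nat" where \<phi>: "strict_mono \<phi>" "\<And>i j. i < j \<Longrightarrow> P (hd (m (\<phi> i))) (hd (m (\<phi> j)))"
      using wqo_on_subseq[OF wqo, of "\<lambda>n. hd (m n)"] mA by blast
    \<comment> \<open>Along \<phi> the heads of m increase, so an embedding between two tails would
      extend to the full words. Hence h is bad too, yet its entry at \<phi> 0 is one letter shorter
      than that of m.\<close>
    define h where "h n = (if n < \<phi> 0 then m n else tl (m (\<phi> (n - \<phi> 0))))" for n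
    have \<phi>0: "\<phi> 0 \<le> \<phi> n" for n using \<phi>(1) by (simp add: strict_mono_less_eq)
    have tl_emb: "list_emb P xs (m n)" if "list_emb P xs (tl (m n))" for xs n
      using that ne[of n] by (cases "m n") auto
    have "bad h"
      unfolding bad_def
    proof (intro conjI allI impI subsetI)
      fix x assume "x \<in> range h"
      then obtain n where "x = h n" by blast
      moreover have "m n \<in> lists A" using bad_m unfolding bad_def by blast
      ultimately show "x \<in> lists A" using mA(2) by (simp add: h_def)
    next
      fix i j :: nat assume ij: "i < j"
      show "\<not> list_emb P (h i) (h j)"
      proof
        assume emb: "list_emb P (h i) (h j)"
        consider "j < \<phi> 0" | "i < \<phi> 0" "\<phi> 0 \<le> j" | "\<phi> 0 \<le> i" by linarith
        then show False
        proof cases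
          case 1
          then show False using emb ij bad_m by (auto simp: h_def bad_def)
        next
          case 2
          then have "list_emb P (m i) (m (\<phi> (j - \<phi> 0)))" using emb tl_emb by (simp add: h_def)
          moreover have "i < \<phi> (j - \<phi> 0)" using 2(1) \<phi>0[of "j - \<phi> 0"] by linarith
          ultimately show False using bad_m by (auto simp: bad_def)
        next
          case 3
          let ?a = "\<phi> (i - \<phi> 0)" and ?b = "\<phi> (j - \<phi> 0)"
          have lt: "i - \<phi> 0 < j - \<phi> 0" using 3 ij by simp
          have "list_emb P (tl (m ?a)) (tl (m ?b))" using emb 3 ij by (simp add: h_def)
          then have "list_emb P (hd (m ?a) # tl (m ?a)) (hd (m ?b) # tl (m ?b))"
            using \<phi>(2)[OF lt] by (rule list_emb_Cons2[rotated])
          then have "list_emb P (m ?a) (m ?b)" using ne by simp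
          then show False using bad_m strict_monoD[OF \<phi>(1) lt] by (auto simp: bad_def)
        qed
      qed
    qed
    then have "length (m (\<phi> 0)) \<le> length (h (\<phi> 0))" by (rule min_m) (simp add: h_def)
    then show False using ne[of "\<phi> 0"] by (simp add: h_def) (metis diff_Suc_less length_greater_0_conv not_less)
  qed
  moreover have "reflp_on (lists A) (list_emb P)"
    using refl by (auto simp: reflp_on_def intro!: list_emb_refl)
  moreover have "transp_on (lists A) (list_emb P)"
  proof (rule transp_onI)
    fix xs ys zs assume *: "xs \<in> lists A" "ys \<in> lists A" "zs \<in> lists A" "list_emb P xs ys" "list_emb P ys zs"
    show "list_emb P xs zs"
      by (rule list_emb_trans[OF _ *(4,5)]) (use *(1-3) trans in \<open>auto dest: transp_onD\<close>)
  qed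
  ultimately show ?thesis unfolding wqo_on_def bad_def by blast
qed

lemma list_emb_imp_strict_mono_index:
  assumes "list_emb P xs ys"
  shows "\<exists>\<rho>. strict_mono_on {..<length xs} \<rho> \<and> (\<forall>j<length xs. \<rho> j < length ys \<and> P (xs ! j) (ys ! \<rho> j))"
  using assms
proof induction
  case (list_emb_Nil ys)
  show ?case by (auto simp: strict_mono_on_def)
next
  case (list_emb_Cons xs ys y)
  then obtain \<rho> where \<rho>: "strict_mono_on {..<length xs} \<rho>" "\<And>j. j < length xs \<Longrightarrow> \<rho> j < length ys \<and> P (xs ! j) (ys ! \<rho> j)"
    by blast
  show ?case
    by (rule exI[of _ "\<lambda>j. Suc (\<rho> j)"]) (use \<rho> in \<open>auto simp: strict_mono_on_def\<close>)
next
  case (list_emb_Cons2 x y xs ys)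
  then obtain \<rho> where \<rho>: "strict_mono_on {..<length xs} \<rho>" "\<And>j. j < length xs \<Longrightarrow> \<rho> j < length ys \<and> P (xs ! j) (ys ! \<rho> j)"
    by blast
  define \<sigma> where "\<sigma> j = (case j of 0 \<Rightarrow> 0 | Suc k \<Rightarrow> Suc (\<rho> k))" for j
  have "strict_mono_on {..<length (x # xs)} \<sigma>"
    using \<rho>(1) by (auto simp: strict_mono_on_def \<sigma>_def split: nat.split)
  moreover have "\<sigma> j < length (y # ys) \<and> P ((x # xs) ! j) ((y # ys) ! \<sigma> j)" if "j < length (x # xs)" for j
    using that \<rho>(2) list_emb_Cons2(1) by (auto simp: \<sigma>_def split: nat.split)
  ultimately show ?case by blast
qed

section \<open>Monomial ideals and primes generated by variables\<close>

abbreviation keys where "keys \<equiv> Poly_Mapping.keys"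
abbreviation lookup where "lookup \<equiv> Poly_Mapping.lookup"
abbreviation single where "single \<equiv> Poly_Mapping.single"
abbreviation vars :: "nat \<Rightarrow> nat \<Rightarrow> var set" where "vars c n \<equiv> {1..c} \<times> {1..n}"

section \<open>Exponent vectors, polynomial rings and monomial ideals\<close>

lemma keys_add_nat: "keys (u + v) = keys u \<union> keys (v :: 'b \<Rightarrow>\<^sub>0 nat)"
  by (auto simp: in_keys_iff lookup_add)

lemma power_products_add: "u + v \<in> power_products c n \<longleftrightarrow> u \<in> power_products c n \<and> v \<in> power_products c n"
  by (auto simp: power_products_def keys_add_nat)

lemma zero_in_power_products [simp]: "0 \<in> power_products c n"
  by (simp add: power_products_def)

lemma single_in_power_products [simp]: "a \<noteq> 0 \<Longrightarrow> single x a \<in> power_products c n \<longleftrightarrow> x \<in> vars c n"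
  by (auto simp: power_products_def)

text \<open>Divisibility of monomials, in additive notation for exponent vectors.\<close>

definition adds :: "power_product \<Rightarrow> power_product \<Rightarrow> bool" where
  "adds u v \<longleftrightarrow> (\<forall>x. lookup u x \<le> lookup v x)"

lemma adds_iff: "adds u v \<longleftrightarrow> (\<exists>w. v = u + w)"
proof
  assume "adds u v"
  then have "lookup u x \<le> lookup v x" for x unfolding adds_def by blast
  then have "v = u + (v - u)" by (intro poly_mapping_eqI) (simp add: lookup_add minus_poly_mapping.rep_eq)
  then show "\<exists>w. v = u + w" by blast
qed (auto simp: adds_def lookup_add)

lemma adds_refl: "adds u u" by (simp add: adds_def)

lemma adds_trans: "adds u v \<Longrightarrow> adds v w \<Longrightarrow> adds u w"
  unfolding adds_def using order_trans by blast

lemma adds_keys: "adds u v \<Longrightarrow> keys u \<subseteq> keys v"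
  unfolding adds_def by (metis in_keys_iff le_zero_eq subsetI)

definition total_degree :: "nat \<Rightarrow> nat \<Rightarrow> power_product \<Rightarrow> nat" where
  "total_degree c n u = (\<Sum>x\<in>vars c n. lookup u x)"

lemma total_degree_less:
  assumes "v \<in> power_products c n" "adds u v" "u \<noteq> v"
  shows "total_degree c n u < total_degree c n v"
proof -
  obtain x where "lookup u x \<noteq> lookup v x" using assms(3) poly_mapping_eqI by metis
  then have x: "lookup u x < lookup v x" using assms(2) unfolding adds_def by (metis order_less_le)
  then have "x \<in> keys v" by (simp add: in_keys_iff)
  then have "x \<in> vars c n" using assms(1) by (auto simp: power_products_def)
  then show ?thesis
    unfolding total_degree_def by (intro sum_strict_mono_ex1) (use x assms(2) \<open>x \<in> vars c n\<close> in \<open>unfold adds_def, blast+\<close>)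
qed

lemma poly_ring_simps [simp]:
  "carrier (poly_ring c n) = {f. keys f \<subseteq> power_products c n}"
  "mult (poly_ring c n) = (*)" "one (poly_ring c n) = 1"
  "zero (poly_ring c n) = 0" "add (poly_ring c n) = (+)"
  by (simp_all add: poly_ring_def)

lemma keys_mult_subset:
  assumes "keys f \<subseteq> power_products c n" "keys g \<subseteq> power_products c n"
  shows "keys (f * g) \<subseteq> power_products c n"
  using keys_mult[of f g] assms by (auto simp: power_products_add subset_iff)

lemma keys_add_subset:
  assumes "keys f \<subseteq> U" "keys g \<subseteq> U"
  shows "keys (f + g) \<subseteq> U"
  using Poly_Mapping.keys_add[of f g] assms by blast

lemma cring_poly_ring: "cring (poly_ring c n :: 'a::field mpoly ring)"
proof (intro cringI abelian_groupI comm_monoidI; simp)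
  fix f :: "'a mpoly" assume "keys f \<subseteq> power_products c n"
  then show "\<exists>g. keys g \<subseteq> power_products c n \<and> g + f = 0"
    by (intro exI[of _ "- f"]) (simp add: keys_minus)
qed (simp_all add: keys_mult_subset keys_add_subset algebra_simps)

lemma ring_poly_ring: "ring (poly_ring c n :: 'a::field mpoly ring)"
  using cring_poly_ring cring.axioms(1) by blast

lemma keys_uminus: "keys (- f) = keys (f :: 'b \<Rightarrow>\<^sub>0 'c::ab_group_add)"
  by (auto simp: in_keys_iff)

lemma poly_ring_a_inv:
  assumes "keys (f :: 'a::field mpoly) \<subseteq> power_products c n"
  shows "a_inv (poly_ring c n) f = - f"
proof -
  interpret cring "poly_ring c n :: 'a mpoly ring" by (rule cring_poly_ring)
  show ?thesis by (rule minus_equality) (use assms in \<open>simp_all add: keys_uminus\<close>)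
qed

lemma poly_ring_idealI:
  assumes sub: "J \<subseteq> {f. keys f \<subseteq> power_products c n}" and zero: "(0 :: 'a::field mpoly) \<in> J"
    and add: "\<And>f g. f \<in> J \<Longrightarrow> g \<in> J \<Longrightarrow> f + g \<in> J"
    and mult: "\<And>f g. f \<in> J \<Longrightarrow> keys g \<subseteq> power_products c n \<Longrightarrow> g * f \<in> J"
  shows "ideal J (poly_ring c n)"
proof (rule idealI[OF ring_poly_ring])
  interpret cring "poly_ring c n :: 'a mpoly ring" by (rule cring_poly_ring)
  have "- f \<in> J" if "f \<in> J" for f
    using mult[OF that, of "- 1"] by (simp add: keys_uminus)
  then show "subgroup J (add_monoid (poly_ring c n))"
    using sub zero add by (intro add.subgroupI) (auto simp: poly_ring_a_inv simp flip: a_inv_def)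
  show "x \<otimes>\<^bsub>poly_ring c n\<^esub> a \<in> J" "a \<otimes>\<^bsub>poly_ring c n\<^esub> x \<in> J"
    if "a \<in> J" "x \<in> carrier (poly_ring c n)" for a x
    using mult[of a x] that by (simp_all add: mult.commute)
qed

lemma poly_ring_idealD:
  assumes "ideal J (poly_ring c n :: 'a::field mpoly ring)"
  shows "f \<in> J \<Longrightarrow> keys f \<subseteq> power_products c n" "0 \<in> J"
    "f \<in> J \<Longrightarrow> g \<in> J \<Longrightarrow> f + g \<in> J"
    "f \<in> J \<Longrightarrow> keys g \<subseteq> power_products c n \<Longrightarrow> g * f \<in> J"
    "f \<in> J \<Longrightarrow> g \<in> J \<Longrightarrow> f - g \<in> J"
proof -
  interpret ideal J "poly_ring c n" by fact
  show c: "f \<in> J \<Longrightarrow> keys f \<subseteq> power_products c n" for f using a_subset by auto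
  show z: "0 \<in> J" using additive_subgroup.zero_closed[OF additive_subgroup_axioms] by simp
  show a: "f \<in> J \<Longrightarrow> g \<in> J \<Longrightarrow> f + g \<in> J" for f g
    using additive_subgroup.a_closed[OF additive_subgroup_axioms, of f g] by simp
  show m: "f \<in> J \<Longrightarrow> keys g \<subseteq> power_products c n \<Longrightarrow> g * f \<in> J" for f g using I_l_closed[of f g] by simp
  show "f \<in> J \<Longrightarrow> g \<in> J \<Longrightarrow> f - g \<in> J"
    using a[of f "- 1 * g"] m[of g "- 1"] by (simp add: keys_uminus)
qed

lemma ideal_sum_closed:
  assumes "ideal J (poly_ring c n :: 'a::field mpoly ring)" "\<And>x. x \<in> X \<Longrightarrow> g x \<in> J"
  shows "sum g X \<in> J"
  using assms(2) by (induction X rule: infinite_finite_induct) (simp_all add: poly_ring_idealD(2,3)[OF assms(1)])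

lemma poly_mapping_eq_sum_single: "f = (\<Sum>u\<in>keys f. single u (lookup f u))"
proof (rule poly_mapping_eqI)
  fix v
  have "lookup (\<Sum>u\<in>keys f. single u (lookup f u)) v = (\<Sum>u\<in>keys f. if u = v then lookup f v else 0)"
    by (simp add: lookup_sum lookup_single when_def cong: if_cong)
  also have "\<dots> = lookup f v" by (simp add: in_keys_iff)
  finally show "lookup f v = lookup (\<Sum>u\<in>keys f. single u (lookup f u)) v" by simp
qed

lemma mono_poly_mult: "mono_poly (u + v) = mono_poly u * mono_poly v"
  by (simp add: mono_poly_def mult_single)

lemma keys_mono_poly [simp]: "keys (mono_poly u :: 'a::field mpoly) = {u}"
  by (simp add: mono_poly_def)

lemma mono_poly_zero: "mono_poly 0 = 1"
  by (simp add: mono_poly_def)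

lemma ideal_memI:
  assumes J: "ideal J (poly_ring c n :: 'a::field mpoly ring)" and "\<And>u. u \<in> keys f \<Longrightarrow> mono_poly u \<in> J"
  shows "f \<in> J"
proof -
  have "single u (lookup f u) \<in> J" if "u \<in> keys f" for u
  proof -
    have "single 0 (lookup f u) * mono_poly u \<in> J"
      by (rule poly_ring_idealD(4)[OF J]) (use assms(2) that in auto)
    then show ?thesis by (simp add: mono_poly_def mult_single)
  qed
  then have "(\<Sum>u\<in>keys f. single u (lookup f u)) \<in> J" by (rule ideal_sum_closed[OF J])
  then show ?thesis using poly_mapping_eq_sum_single[of f] by simp
qed

text \<open>The working form of a monomial ideal: if U is closed under multiples, this is an ideal
  whose membership is tested one monomial at a time.\<close>

definition supported :: "nat \<Rightarrow> nat \<Rightarrow> power_product set \<Rightarrow> 'a::field mpoly set" where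
  "supported c n U = {f. keys f \<subseteq> power_products c n \<inter> U}"

lemma supported_ideal:
  assumes "\<And>u v. u \<in> U \<Longrightarrow> adds u v \<Longrightarrow> v \<in> U"
  shows "ideal (supported c n U :: 'a::field mpoly set) (poly_ring c n)"
proof (rule poly_ring_idealI)
  fix f g :: "'a mpoly" assume f: "f \<in> supported c n U" and g: "keys g \<subseteq> power_products c n"
  have "u \<in> power_products c n \<inter> U" if u: "u \<in> keys (g * f)" for u
  proof -
    obtain a b where ab: "u = a + b" "a \<in> keys g" "b \<in> keys f" using subsetD[OF keys_mult u] by blast
    then have "adds b u" by (metis adds_iff add.commute)
    then show ?thesis using ab f g assms[of b u] by (auto simp: supported_def power_products_add)
  qed
  then show "g * f \<in> supported c n U" by (auto simp: supported_def)
qed (auto simp: supported_def dest!: subsetD[OF Poly_Mapping.keys_add])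

text \<open>The right-hand side is an ideal containing the generators. Conversely, each of its
  elements is a sum of constant multiples of monomials that some generator divides.\<close>

lemma Idl_monomials:
  assumes "S \<subseteq> power_products c n"
  shows "Idl\<^bsub>poly_ring c n\<^esub> (mono_poly ` S) = (supported c n {u. \<exists>s\<in>S. adds s u} :: 'a::field mpoly set)"
    (is "_ = ?J")
proof
  interpret cring "poly_ring c n :: 'a mpoly ring" by (rule cring_poly_ring)
  have mono: "mono_poly ` S \<subseteq> carrier (poly_ring c n :: 'a mpoly ring)" using assms by auto
  have J: "ideal ?J (poly_ring c n)" by (rule supported_ideal) (use adds_trans in blast)
  show "Idl\<^bsub>poly_ring c n\<^esub> (mono_poly ` S) \<subseteq> ?J"
    by (rule genideal_minimal[OF J]) (use assms adds_refl in \<open>force simp: supported_def\<close>)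
  have I: "ideal (Idl\<^bsub>poly_ring c n\<^esub> (mono_poly ` S)) (poly_ring c n :: 'a mpoly ring)"
    by (rule genideal_ideal) (use assms in auto)
  show "?J \<subseteq> Idl\<^bsub>poly_ring c n\<^esub> (mono_poly ` S)"
  proof
    fix f assume f: "f \<in> ?J"
    show "f \<in> Idl\<^bsub>poly_ring c n\<^esub> (mono_poly ` S)"
    proof (rule ideal_memI[OF I])
      fix u assume u: "u \<in> keys f"
      then obtain s w where s: "s \<in> S" "u = s + w" using f by (auto simp: supported_def adds_iff)
      have "mono_poly s \<in> Idl\<^bsub>poly_ring c n :: 'a mpoly ring\<^esub> (mono_poly ` S)"
        by (rule subsetD[OF genideal_self[OF mono]]) (rule imageI[OF s(1)])
      then have "mono_poly w * mono_poly s \<in> Idl\<^bsub>poly_ring c n :: 'a mpoly ring\<^esub> (mono_poly ` S)"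
        by (rule poly_ring_idealD(4)[OF I]) (use u f s in \<open>auto simp: supported_def power_products_add\<close>)
      then show "(mono_poly u :: 'a mpoly) \<in> Idl\<^bsub>poly_ring c n\<^esub> (mono_poly ` S)"
        by (simp add: s(2) mono_poly_mult mult.commute)
    qed
  qed
qed

definition monomials :: "'a::field mpoly set \<Rightarrow> power_product set" where
  "monomials J = {u. mono_poly u \<in> J}"

lemma monomials_supported: "monomials (supported c n U :: 'a::field mpoly set) = power_products c n \<inter> U"
  by (auto simp: monomials_def supported_def)

lemma monomials_adds:
  assumes "ideal J (poly_ring c n :: 'a::field mpoly ring)" "u \<in> monomials J" "adds u v" "v \<in> power_products c n"
  shows "v \<in> monomials J"
proof -
  obtain w where w: "v = u + w" using assms(3) adds_iff by blast
  have "mono_poly w * mono_poly u \<in> J"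
    by (rule poly_ring_idealD(4)[OF assms(1)])
      (use assms(2,4) w in \<open>auto simp: monomials_def power_products_add\<close>)
  then show ?thesis by (simp add: monomials_def w mono_poly_mult mult.commute)
qed

lemma monomial_ideal_supported:
  assumes "monomial_ideal c n (J :: 'a::field mpoly set)"
  shows "J = supported c n (monomials J)" "monomials J \<subseteq> power_products c n"
proof -
  obtain S where S: "S \<subseteq> power_products c n" "J = Idl\<^bsub>poly_ring c n\<^esub> (mono_poly ` S)"
    using assms by (auto simp: monomial_ideal_def)
  then have J: "J = supported c n {u. \<exists>s\<in>S. adds s u}" by (simp add: Idl_monomials)
  then have m: "monomials J = power_products c n \<inter> {u. \<exists>s\<in>S. adds s u}" by (simp add: monomials_supported)
  then show "monomials J \<subseteq> power_products c n" by blast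
  show "J = supported c n (monomials J)" unfolding m by (subst J) (simp add: supported_def)
qed

lemma monomial_ideal_proper_iff:
  assumes "monomial_ideal c n (J :: 'a::field mpoly set)"
  shows "J = carrier (poly_ring c n) \<longleftrightarrow> 0 \<in> monomials J"
proof
  assume "0 \<in> monomials J"
  moreover have "ideal J (poly_ring c n)" using assms by (simp add: monomial_ideal_def)
  ultimately show "J = carrier (poly_ring c n)"
    using ideal.one_imp_carrier by (fastforce simp: monomials_def mono_poly_zero)
qed (simp add: monomials_def)

text \<open>A generating set contains a divisor of each monomial of J, hence every monomial of J
  minimal under divisibility. By descent on the degree these minimal ones already generate J, so the
  irredundant generating set is unique and the description in \<open>min_gens\<close> denotes
  it.\<close>

lemma min_gens_eq:
  assumes J: "monomial_ideal c n (J :: 'a::field mpoly set)"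
  shows "min_gens c n J = {u \<in> monomials J. \<forall>s\<in>monomials J. adds s u \<longrightarrow> s = u}" (is "_ = ?M")
    and "u \<in> monomials J \<Longrightarrow> \<exists>s\<in>min_gens c n J. adds s u"
proof -
  have id: "ideal J (poly_ring c n)" using J by (simp add: monomial_ideal_def)
  have sub: "monomials J \<subseteq> power_products c n" by (rule monomial_ideal_supported[OF J])
  have below: "\<exists>s\<in>?M. adds s u" if "u \<in> monomials J" for u
    using that
  proof (induction "total_degree c n u" arbitrary: u rule: less_induct)
    case less
    show ?case
    proof (cases "u \<in> ?M")
      case True
      then show ?thesis using adds_refl by blast
    next
      case False
      then obtain s where s: "s \<in> monomials J" "adds s u" "s \<noteq> u" using less.prems by blast
      then show ?thesis using less.hyps[of s] total_degree_less[of u c n s] sub less.prems adds_trans by blast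
    qed
  qed
  have gen: "Idl\<^bsub>poly_ring c n\<^esub> (mono_poly ` S) = J \<longleftrightarrow> power_products c n \<inter> {u. \<exists>s\<in>S. adds s u} = monomials J"
    if "S \<subseteq> power_products c n" for S
  proof -
    have "(supported c n {u. \<exists>s\<in>S. adds s u} = J) \<longleftrightarrow> (power_products c n \<inter> {u. \<exists>s\<in>S. adds s u} = monomials J)"
      (is "?L \<longleftrightarrow> ?U = _")
    proof
      assume ?L
      then show "?U = monomials J" by (subst monomials_supported[symmetric, where 'a='a]) simp
    next
      assume U: "?U = monomials J"
      show ?L by (subst monomial_ideal_supported(1)[OF J]) (simp add: supported_def flip: U)
    qed
    then show ?thesis using Idl_monomials[OF that, where 'a='a] by simp
  qed
  have M1: "?M \<subseteq> power_products c n" using sub by blast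
  have M2: "Idl\<^bsub>poly_ring c n\<^esub> (mono_poly ` ?M) = J"
    unfolding gen[OF M1] using below monomials_adds[OF id] sub by fast
  have M3: "Idl\<^bsub>poly_ring c n\<^esub> (mono_poly ` T) \<noteq> J" if T: "T \<subset> ?M" for T
  proof
    assume *: "Idl\<^bsub>poly_ring c n\<^esub> (mono_poly ` T) = J"
    obtain u where u: "u \<in> ?M" "u \<notin> T" using T by blast
    have "T \<subseteq> power_products c n" using T M1 by blast
    then have "u \<in> {u. \<exists>s\<in>T. adds s u}" using gen * u(1) by blast
    then show False using u T by blast
  qed
  show eq: "min_gens c n J = ?M"
    unfolding min_gens_def
  proof (rule the_equality)
    show "?M \<subseteq> power_products c n \<and> Idl\<^bsub>poly_ring c n\<^esub> (mono_poly ` ?M) = J \<and>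
       (\<forall>T. T \<subset> ?M \<longrightarrow> Idl\<^bsub>poly_ring c n\<^esub> (mono_poly ` T) \<noteq> J)" using M1 M2 M3 by blast
  next
    fix S assume S: "S \<subseteq> power_products c n \<and> Idl\<^bsub>poly_ring c n\<^esub> (mono_poly ` S) = J \<and>
       (\<forall>T. T \<subset> S \<longrightarrow> Idl\<^bsub>poly_ring c n\<^esub> (mono_poly ` T) \<noteq> J)"
    then have up: "power_products c n \<inter> {u. \<exists>s\<in>S. adds s u} = monomials J" using gen by blast
    have "?M \<subseteq> S"
    proof
      fix u assume u: "u \<in> ?M"
      then obtain s where s: "s \<in> S" "adds s u" using up by blast
      then have "s \<in> monomials J" using up S adds_refl by blast
      then show "u \<in> S" using u s by blast
    qed
    then show "S = ?M" using S M2 by blast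
  qed
  show "u \<in> monomials J \<Longrightarrow> \<exists>s\<in>min_gens c n J. adds s u" using below eq by simp
qed

section \<open>Primes generated by variables\<close>

definition var_ideal :: "nat \<Rightarrow> nat \<Rightarrow> var set \<Rightarrow> 'a::field mpoly set" where
  "var_ideal c n W = supported c n {u. keys u \<inter> W \<noteq> {}}"

lemma var_ideal_prime: "primeideal (var_ideal c n W :: 'a::field mpoly set) (poly_ring c n)"
proof (rule primeidealI[OF _ cring_poly_ring])
  let ?P = "var_ideal c n W :: 'a mpoly set"
  show P: "ideal ?P (poly_ring c n)"
    unfolding var_ideal_def by (rule supported_ideal) (use adds_keys in blast)
  have "(1 :: 'a mpoly) \<notin> ?P" by (simp add: var_ideal_def supported_def)
  then show "carrier (poly_ring c n) \<noteq> ?P" by (auto simp: set_eq_iff)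
  fix f g :: "'a mpoly"
  assume fg: "f \<in> carrier (poly_ring c n)" "g \<in> carrier (poly_ring c n)" "f \<otimes>\<^bsub>poly_ring c n\<^esub> g \<in> ?P"
  \<comment> \<open>Reduction modulo the ideal: every term involving a variable of W is deleted.
    Since r f * r g is congruent to f * g, it lies in the ideal, while all its monomials avoid W; so
    it vanishes.\<close>
  define r where "r h = Poly_Mapping.mapp (\<lambda>u a. if keys u \<inter> W = {} then a else 0) h" for h :: "'a mpoly"
  have lookup_r: "lookup (r h) u = (if keys u \<inter> W = {} then lookup h u else 0)" for h u
    by (simp add: r_def lookup_mapp when_def in_keys_iff)
  have keys_r: "keys (r h) \<subseteq> keys h \<inter> {u. keys u \<inter> W = {}}" for h
  proof
    fix u assume "u \<in> keys (r h)"
    then show "u \<in> keys h \<inter> {u. keys u \<inter> W = {}}"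
      by (cases "keys u \<inter> W = {}") (simp_all add: in_keys_iff[of u] lookup_r)
  qed
  have diff: "h - r h \<in> ?P" if "keys h \<subseteq> power_products c n" for h
  proof -
    have "u \<in> keys h \<and> keys u \<inter> W \<noteq> {}" if "u \<in> keys (h - r h)" for u
      using that by (cases "keys u \<inter> W = {}") (simp_all add: in_keys_iff[of u] lookup_minus lookup_r)
    then show ?thesis using that unfolding var_ideal_def supported_def by blast
  qed
  have kf: "keys f \<subseteq> power_products c n" and kg: "keys g \<subseteq> power_products c n" using fg by auto
  have krf: "keys (r f) \<subseteq> power_products c n" using keys_r[of f] kf by blast
  have "r f * r g = f * g - (r f * (g - r g) + g * (f - r f))" by (simp add: algebra_simps)
  also have "\<dots> \<in> ?P"
    using fg(3) diff[OF kf] diff[OF kg] kg krf poly_ring_idealD(3,4,5)[OF P] by simp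
  finally have in_P: "keys (r f * r g) \<subseteq> {u. keys u \<inter> W \<noteq> {}}" by (auto simp: var_ideal_def supported_def)
  have "keys (r f * r g) \<subseteq> {u. keys u \<inter> W = {}}"
    using keys_mult[of "r f" "r g"] keys_r[of f] keys_r[of g] by (fastforce simp: keys_add_nat)
  with in_P have "keys (r f * r g) = {}" by blast
  then have "r f * r g = 0" by simp
  \<comment> \<open>The polynomials form a domain; this rests on a linear order of the exponent
    vectors, induced by the lexicographic order on the variables.\<close>
  then have "r f = 0 \<or> r g = 0" by simp
  then show "f \<in> ?P \<or> g \<in> ?P" using diff[OF kf] diff[OF kg] by auto
qed

lemma var_ideal_strict_mono:
  assumes "W \<subset> W'" "W' \<subseteq> vars c n"
  shows "var_ideal c n W \<subset> (var_ideal c n W' :: 'a::field mpoly set)"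
proof -
  obtain x where x: "x \<in> W'" "x \<notin> W" using assms(1) by blast
  have "mono_poly (single x 1) \<in> (var_ideal c n W' :: 'a mpoly set) - var_ideal c n W"
    using x assms(2) by (auto simp: var_ideal_def supported_def)
  moreover have "var_ideal c n W \<subseteq> (var_ideal c n W' :: 'a mpoly set)"
    using assms(1) by (fastforce simp: var_ideal_def supported_def)
  ultimately show ?thesis by blast
qed

lemma primeidealD:
  assumes "primeideal P (poly_ring c n :: 'a::field mpoly ring)"
  shows "ideal P (poly_ring c n)" "1 \<notin> P"
    "keys f \<subseteq> power_products c n \<Longrightarrow> keys g \<subseteq> power_products c n \<Longrightarrow> f * g \<in> P \<Longrightarrow> f \<in> P \<or> g \<in> P"
proof -
  interpret primeideal P "poly_ring c n" by fact
  show "ideal P (poly_ring c n)" by (rule is_ideal)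
  show "1 \<notin> P" using one_imp_carrier I_notcarr by auto
  show "keys f \<subseteq> power_products c n \<Longrightarrow> keys g \<subseteq> power_products c n \<Longrightarrow> f * g \<in> P \<Longrightarrow> f \<in> P \<or> g \<in> P"
    using I_prime[of f g] by simp
qed

text \<open>Split off one variable of u: primality puts either it or the cofactor, of smaller
  degree, into P. The descent cannot end in the monomial 1, because P is proper.\<close>

lemma prime_monomial_has_var:
  assumes P: "primeideal P (poly_ring c n :: 'a::field mpoly ring)"
    and u: "u \<in> monomials P"
  shows "\<exists>x\<in>keys u. single x 1 \<in> monomials P"
  using u
proof (induction "total_degree c n u" arbitrary: u rule: less_induct)
  case less
  have id: "ideal P (poly_ring c n)" by (rule primeidealD(1)[OF P])
  have up: "u \<in> power_products c n"
    using poly_ring_idealD(1)[OF id, of "mono_poly u"] less.prems by (simp add: monomials_def)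
  have "u \<noteq> 0" using less.prems primeidealD(2)[OF P] by (auto simp: monomials_def mono_poly_zero)
  then obtain x where x: "x \<in> keys u" by (metis keys_eq_empty ex_in_conv)
  have "adds (single x 1) u"
    using x by (auto simp: adds_def lookup_single when_def in_keys_iff)
  then obtain v where v: "u = single x 1 + v" using adds_iff by blast
  have pp: "single x 1 \<in> power_products c n" "v \<in> power_products c n" using up v power_products_add by blast+
  have "mono_poly (single x 1) * mono_poly v \<in> P"
    using less.prems v by (simp add: monomials_def mono_poly_mult)
  then consider "single x 1 \<in> monomials P" | "v \<in> monomials P"
    using primeidealD(3)[OF P, of "mono_poly (single x 1)" "mono_poly v"] pp by (auto simp: monomials_def)
  then show ?case
  proof cases
    case 1
    then show ?thesis using x by blast
  next
    case 2
    have "adds v u" by (metis adds_iff v add.commute)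
    moreover have "v \<noteq> u" using v by (metis add_cancel_right_left lookup_single_eq lookup_zero zero_neq_one)
    ultimately have "\<exists>y\<in>keys v. single y 1 \<in> monomials P" using less.hyps[OF _ 2] total_degree_less up by blast
    then show ?thesis using adds_keys[OF \<open>adds v u\<close>] by blast
  qed
qed

lemma var_ideal_subset:
  assumes "ideal P (poly_ring c n :: 'a::field mpoly ring)" "\<And>x. x \<in> W \<inter> vars c n \<Longrightarrow> single x 1 \<in> monomials P"
  shows "var_ideal c n W \<subseteq> P"
proof
  fix f :: "'a mpoly" assume f: "f \<in> var_ideal c n W"
  show "f \<in> P"
  proof (rule ideal_memI[OF assms(1)])
    fix u assume "u \<in> keys f"
    then have u: "u \<in> power_products c n" "keys u \<inter> W \<noteq> {}" using f by (auto simp: var_ideal_def supported_def)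
    then obtain x where x: "x \<in> keys u" "x \<in> W" by blast
    then have "x \<in> vars c n" using u(1) by (auto simp: power_products_def)
    have "adds (single x 1) u"
      using x by (auto simp: adds_def lookup_single when_def in_keys_iff)
    then have "u \<in> monomials P"
      using monomials_adds[OF assms(1) assms(2)[of x] _ u(1)] x \<open>x \<in> vars c n\<close> by blast
    then show "mono_poly u \<in> P" by (simp add: monomials_def)
  qed
qed

section \<open>Heights of primes and codimension of monomial ideals\<close>

lemma vector_space_mpoly: "vector_space (\<lambda>a (f :: 'a::field mpoly). single 0 a * f)"
  by unfold_locales (simp_all add: distrib_left distrib_right single_add mult_single flip: mult.assoc)

text \<open>The head of a list of length L + 1 is the exponent of \<open>f L\<close>, the witness
  belonging to the smallest prime, so the induction on L in
  \<open>chain_witnesses_independent\<close> strips heads.\<close>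

primrec power_prod :: "(nat \<Rightarrow> 'a::field mpoly) \<Rightarrow> nat list \<Rightarrow> 'a mpoly" where
  "power_prod f [] = 1"
| "power_prod f (a # as) = f (length as) ^ a * power_prod f as"

lemma keys_power_subset:
  assumes "keys (f :: 'a::field mpoly) \<subseteq> power_products c n"
  shows "keys (f ^ m) \<subseteq> power_products c n"
  by (induction m) (simp_all add: keys_mult_subset assms)

lemma keys_power_prod_subset:
  assumes "\<And>k. k < length \<alpha> \<Longrightarrow> keys (f k :: 'a::field mpoly) \<subseteq> power_products c n"
  shows "keys (power_prod f \<alpha>) \<subseteq> power_products c n"
  using assms by (induction \<alpha>) (simp_all add: keys_mult_subset keys_power_subset)

lemma keys_const_subset [simp]: "keys (single 0 a :: 'a::field mpoly) \<subseteq> power_products c n"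
  by (cases "a = 0") simp_all

lemma keys_sum_subset:
  assumes "\<And>x. x \<in> X \<Longrightarrow> keys (g x :: 'a::field mpoly) \<subseteq> power_products c n"
  shows "keys (sum g X) \<subseteq> power_products c n"
  using assms by (induction X rule: infinite_finite_induct) (simp_all add: keys_add_subset)

text \<open>Elements witnessing the strict inclusions of a chain of primes are algebraically
  independent: in a relation, cancel the lowest power of the first witness, which lies outside the
  smallest prime; modulo the next prime only the terms without that witness survive. Repeating
  this shows that a nonzero constant lies in the largest prime.\<close>

lemma chain_witnesses_independent:
  fixes Q :: "nat \<Rightarrow> 'a::field mpoly set"
  assumes "\<And>k. k \<le> L \<Longrightarrow> primeideal (Q k) (poly_ring c n)"
    and "\<And>k. k < L \<Longrightarrow> Q (Suc k) \<subseteq> Q k" "\<And>k. k < L \<Longrightarrow> f k \<in> Q k - Q (Suc k)"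
    and "finite A" "A \<noteq> {}" "\<And>\<alpha>. \<alpha> \<in> A \<Longrightarrow> length \<alpha> = L" "\<And>\<alpha>. \<alpha> \<in> A \<Longrightarrow> a \<alpha> \<noteq> 0"
  shows "(\<Sum>\<alpha>\<in>A. single 0 (a \<alpha>) * power_prod f \<alpha>) \<notin> Q L"
  using assms
proof (induction L arbitrary: A a)
  case 0
  have id: "ideal (Q 0) (poly_ring c n)" "1 \<notin> Q 0" using primeidealD(1,2) 0 by blast+
  have "A = {[]}" using 0 by auto
  then have sum: "(\<Sum>\<alpha>\<in>A. single 0 (a \<alpha>) * power_prod f \<alpha>) = single 0 (a [])" and "a [] \<noteq> 0"
    using 0 by auto
  show ?case
  proof
    assume "(\<Sum>\<alpha>\<in>A. single 0 (a \<alpha>) * power_prod f \<alpha>) \<in> Q 0"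
    then have "single 0 (inverse (a [])) * single 0 (a []) \<in> Q 0"
      unfolding sum by (rule poly_ring_idealD(4)[OF id(1)]) simp
    then show False using id(2) \<open>a [] \<noteq> 0\<close> by (simp add: mult_single)
  qed
next
  case (Suc L)
  have prime: "primeideal (Q (Suc L)) (poly_ring c n)" "primeideal (Q L) (poly_ring c n)" using Suc.prems(1) by auto
  note id = primeidealD(1)[OF prime(1)] primeidealD(1)[OF prime(2)]
  have f: "f L \<in> Q L" "f L \<notin> Q (Suc L)" using Suc.prems(3)[of L] by auto
  have kf: "keys (f k) \<subseteq> power_products c n" if "k < Suc L" for k
    using poly_ring_idealD(1)[OF primeidealD(1)[OF Suc.prems(1)[of k]]] Suc.prems(3)[of k] that by auto
  \<comment> \<open>\<open>A0\<close> collects the terms with the lowest exponent m of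
    \<open>f L\<close>. After cancelling \<open>f L ^ m\<close> they form G, free of
    \<open>f L\<close>; all other terms keep at least one factor \<open>f L\<close> and form
    \<open>f L * T\<close>.\<close>
  define m where "m = Min (hd ` A)"
  define A0 where "A0 = {\<alpha> \<in> A. hd \<alpha> = m}"
  have "m \<in> hd ` A" unfolding m_def using Suc.prems(4,5) by (intro Min_in) auto
  then have A0: "A0 \<noteq> {}" "finite A0" "A0 \<subseteq> A" using Suc.prems(4) by (auto simp: A0_def)
  have hd_gt: "m < hd \<alpha>" if "\<alpha> \<in> A - A0" for \<alpha>
  proof -
    have "m \<le> hd \<alpha>" unfolding m_def using that Suc.prems(4) by (intro Min_le) auto
    then show ?thesis using that by (auto simp: A0_def)
  qed
  have split: "power_prod f \<alpha> = f L ^ hd \<alpha> * power_prod f (tl \<alpha>)" if "\<alpha> \<in> A" for \<alpha>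
    using Suc.prems(6)[OF that] by (cases \<alpha>) auto
  have ktl: "keys (power_prod f (tl \<alpha>)) \<subseteq> power_products c n" if "\<alpha> \<in> A" for \<alpha>
    using Suc.prems(6)[OF that] kf by (intro keys_power_prod_subset) auto
  define G where "G = (\<Sum>\<alpha>\<in>A0. single 0 (a \<alpha>) * power_prod f (tl \<alpha>))"
  define T where "T = (\<Sum>\<alpha>\<in>A - A0. single 0 (a \<alpha>) * (f L ^ (hd \<alpha> - m - 1) * power_prod f (tl \<alpha>)))"
  have kG: "keys G \<subseteq> power_products c n"
    unfolding G_def using ktl A0(3) by (intro keys_sum_subset keys_mult_subset keys_const_subset) auto
  have kT: "keys T \<subseteq> power_products c n"
    unfolding T_def using ktl kf by (intro keys_sum_subset keys_mult_subset keys_const_subset keys_power_subset) auto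
  have "(\<Sum>\<alpha>\<in>A. single 0 (a \<alpha>) * power_prod f \<alpha>) =
      (\<Sum>\<alpha>\<in>A - A0. single 0 (a \<alpha>) * power_prod f \<alpha>) + (\<Sum>\<alpha>\<in>A0. single 0 (a \<alpha>) * power_prod f \<alpha>)"
    by (rule sum.subset_diff[OF A0(3) Suc.prems(4)])
  also have "(\<Sum>\<alpha>\<in>A0. single 0 (a \<alpha>) * power_prod f \<alpha>) = f L ^ m * G"
    unfolding G_def sum_distrib_left by (rule sum.cong) (auto simp: A0_def split ac_simps)
  also have "(\<Sum>\<alpha>\<in>A - A0. single 0 (a \<alpha>) * power_prod f \<alpha>) = f L ^ m * (f L * T)"
    unfolding T_def sum_distrib_left
  proof (rule sum.cong[OF refl])
    fix \<alpha> assume \<alpha>: "\<alpha> \<in> A - A0"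
    obtain k where k: "hd \<alpha> = m + 1 + k" using hd_gt[OF \<alpha>] less_iff_Suc_add[of m "hd \<alpha>"] by auto
    show "single 0 (a \<alpha>) * power_prod f \<alpha> =
      f L ^ m * (f L * (single 0 (a \<alpha>) * (f L ^ (hd \<alpha> - m - 1) * power_prod f (tl \<alpha>))))"
      using \<alpha> by (simp add: split k power_add ac_simps)
  qed
  finally have sum: "(\<Sum>\<alpha>\<in>A. single 0 (a \<alpha>) * power_prod f \<alpha>) = f L ^ m * (f L * T + G)"
    by (simp add: distrib_left)
  \<comment> \<open>Heads agree on \<open>A0\<close>, so dropping them is injective and G is again a
    relation of the required form, now in the first L witnesses.\<close>
  have "G = (\<Sum>\<beta>\<in>tl ` A0. single 0 (a (m # \<beta>)) * power_prod f \<beta>)"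
  proof -
    have cons: "m # tl \<alpha> = \<alpha>" if "\<alpha> \<in> A0" for \<alpha>
    proof -
      have "length \<alpha> = Suc L" "hd \<alpha> = m" using that Suc.prems(6) by (auto simp: A0_def)
      then show ?thesis by (cases \<alpha>) auto
    qed
    then have "inj_on tl A0" by (metis inj_onI)
    then show ?thesis unfolding G_def by (subst sum.reindex) (auto simp: cons intro!: sum.cong)
  qed
  moreover have "(\<Sum>\<beta>\<in>tl ` A0. single 0 (a (m # \<beta>)) * power_prod f \<beta>) \<notin> Q L"
  proof (rule Suc.IH)
    fix \<beta> assume "\<beta> \<in> tl ` A0"
    then obtain \<alpha> where \<alpha>: "\<alpha> \<in> A" "hd \<alpha> = m" "\<beta> = tl \<alpha>" by (auto simp: A0_def)
    then show "length \<beta> = L" using Suc.prems(6) by auto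
    have "m # \<beta> = \<alpha>" using \<alpha> Suc.prems(6)[of \<alpha>] by (cases \<alpha>) auto
    then show "a (m # \<beta>) \<noteq> 0" using \<alpha>(1) Suc.prems(7) by simp
  qed (use Suc.prems A0 in auto)
  ultimately have G: "G \<notin> Q L" by simp
  have "f L ^ j \<notin> Q (Suc L)" for j
  proof (induction j)
    case 0
    show ?case using primeidealD(2)[OF prime(1)] by simp
  next
    case (Suc j)
    then show ?case
      using primeidealD(3)[OF prime(1), of "f L" "f L ^ j"] kf f keys_power_subset[OF kf[of L]] by auto
  qed
  \<comment> \<open>As \<open>f L\<close> lies in \<open>Q L\<close> and G does not, the sum is
    outside \<open>Q L\<close>, hence outside the smaller prime \<open>Q (Suc L)\<close>.\<close>
  moreover have "f L * T + G \<notin> Q (Suc L)"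
  proof
    assume "f L * T + G \<in> Q (Suc L)"
    then have "f L * T + G \<in> Q L" using Suc.prems(2)[of L] by auto
    moreover have "T * f L \<in> Q L" using poly_ring_idealD(4)[OF id(2) f(1) kT] .
    ultimately have "(f L * T + G) - T * f L \<in> Q L" by (rule poly_ring_idealD(5)[OF id(2)])
    then show False using G by (simp add: mult.commute)
  qed
  moreover have "keys (f L ^ m) \<subseteq> power_products c n" by (rule keys_power_subset) (simp add: kf)
  moreover have "keys (f L * T + G) \<subseteq> power_products c n"
    by (intro keys_add_subset keys_mult_subset kT kG) (simp add: kf)
  ultimately show ?case
    unfolding sum using primeidealD(3)[OF prime(1), of "f L ^ m" "f L * T + G"] by blast
qed

text \<open>Exponents are bounded one by one instead of through the total degree: the bounds still
  add up under multiplication, and the size is at most a plain power.\<close>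

definition box :: "nat \<Rightarrow> nat \<Rightarrow> nat \<Rightarrow> power_product set" where
  "box c n m = {u \<in> power_products c n. \<forall>x. lookup u x \<le> m}"

lemma card_box: "finite (box c n m) \<and> card (box c n m) \<le> (m + 1) ^ (c * n)"
proof -
  let ?E = "vars c n \<rightarrow>\<^sub>E {0..m}"
  have "inj_on (\<lambda>u. restrict (lookup u) (vars c n)) (box c n m)"
  proof (rule inj_onI, rule poly_mapping_eqI)
    fix u v x assume uv: "u \<in> box c n m" "v \<in> box c n m"
      and eq: "restrict (lookup u) (vars c n) = restrict (lookup v) (vars c n)"
    show "lookup u x = lookup v x"
    proof (cases "x \<in> vars c n")
      case True
      then show ?thesis using fun_cong[OF eq, of x] by simp
    next
      case False
      then have "x \<notin> keys u" "x \<notin> keys v" using uv by (auto simp: box_def power_products_def)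
      then show ?thesis by (simp add: in_keys_iff)
    qed
  qed
  moreover have "(\<lambda>u. restrict (lookup u) (vars c n)) ` box c n m \<subseteq> ?E"
    by (rule image_subsetI) (simp only: restrict_PiE_iff, simp add: box_def)
  moreover have "finite ?E" by (simp add: finite_PiE)
  moreover have "card ?E = (m + 1) ^ (c * n)" by (simp add: card_PiE)
  ultimately show ?thesis by (metis card_inj_on_le inj_on_finite)
qed

lemma keys_mult_box:
  assumes "keys f \<subseteq> box c n d" "keys g \<subseteq> box c n e"
  shows "keys (f * g) \<subseteq> box c n (d + e)"
proof
  fix u assume "u \<in> keys (f * g)"
  then obtain a b where "u = a + b" "a \<in> keys f" "b \<in> keys g" using keys_mult[of f g] by blast
  then show "u \<in> box c n (d + e)"
    using assms by (auto simp: box_def power_products_add lookup_add intro!: add_mono)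
qed

lemma keys_power_box: "keys (f :: 'a::field mpoly) \<subseteq> box c n d \<Longrightarrow> keys (f ^ a) \<subseteq> box c n (a * d)"
proof (induction a)
  case 0
  show ?case by (simp add: box_def)
next
  case (Suc a)
  have "keys (f * f ^ a) \<subseteq> box c n (d + a * d)" by (rule keys_mult_box) (use Suc in auto)
  then show ?case by simp
qed

lemma keys_power_prod_box:
  assumes "\<And>k. k < length \<alpha> \<Longrightarrow> keys (f k :: 'a::field mpoly) \<subseteq> box c n d"
  shows "keys (power_prod f \<alpha>) \<subseteq> box c n (d * sum_list \<alpha>)"
  using assms
proof (induction \<alpha>)
  case Nil
  show ?case by (simp add: box_def)
next
  case (Cons a \<alpha>)
  have "keys (f (length \<alpha>) ^ a * power_prod f \<alpha>) \<subseteq> box c n (a * d + d * sum_list \<alpha>)"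
    using Cons by (intro keys_mult_box keys_power_box) auto
  then show ?case by (simp add: algebra_simps)
qed

lemma finite_set_in_box:
  assumes "finite X" "X \<subseteq> power_products c n"
  shows "\<exists>d. X \<subseteq> box c n d"
proof -
  have "finite (\<Union>u\<in>X. lookup u ` vars c n)" using assms(1) by auto
  then obtain d where d: "\<And>y. y \<in> (\<Union>u\<in>X. lookup u ` vars c n) \<Longrightarrow> y \<le> d"
    by (meson finite_nat_set_iff_bounded_le)
  have "lookup u x \<le> d" if u: "u \<in> X" for u x
  proof (cases "x \<in> vars c n")
    case True
    then show ?thesis using d u by blast
  next
    case False
    then have "x \<notin> keys u" using assms(2) u by (auto simp: power_products_def)
    then show ?thesis by (simp add: in_keys_iff)
  qed
  then have "X \<subseteq> box c n d" using assms(2) unfolding box_def by blast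
  then show ?thesis by blast
qed

text \<open>Compare the number \<open>(t + 1) ^ L\<close> of independent power products of the witnesses with the
  dimension of the space of polynomials that contains them, a polynomial in \<open>t\<close> of degree \<open>c n\<close>.\<close>

lemma prime_chain_length_le:
  fixes Q :: "nat \<Rightarrow> 'a::field mpoly set"
  assumes prime: "\<And>k. k \<le> L \<Longrightarrow> primeideal (Q k) (poly_ring c n)"
    and strict: "\<And>k. k < L \<Longrightarrow> Q (Suc k) \<subset> Q k"
  shows "L \<le> c * n"
proof -
  interpret vs: vector_space "\<lambda>a (f :: 'a mpoly). single 0 a * f" by (rule vector_space_mpoly)
  have "\<exists>x. x \<in> Q k - Q (Suc k)" if "k < L" for k using strict[OF that] by blast
  then obtain f where f: "\<And>k. k < L \<Longrightarrow> f k \<in> Q k - Q (Suc k)" by metis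
  have kf: "keys (f k) \<subseteq> power_products c n" if "k < L" for k
    using poly_ring_idealD(1)[OF primeidealD(1)[OF prime[of k]]] f[OF that] that by auto
  \<comment> \<open>d bounds every exponent in every witness, so a product of L witnesses with
    exponents up to t has all its exponents at most d * (L * t).\<close>
  obtain d where d: "(\<Union>k<L. keys (f k)) \<subseteq> box c n d"
    using finite_set_in_box[of "\<Union>k<L. keys (f k)" c n] kf by auto
  have nonzero: "(\<Sum>\<alpha>\<in>A. single 0 (a \<alpha>) * power_prod f \<alpha>) \<noteq> 0"
    if "finite A" "A \<noteq> {}" "\<And>\<alpha>. \<alpha> \<in> A \<Longrightarrow> length \<alpha> = L" "\<And>\<alpha>. \<alpha> \<in> A \<Longrightarrow> a \<alpha> \<noteq> 0" for A a
  proof -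
    have "(\<Sum>\<alpha>\<in>A. single 0 (a \<alpha>) * power_prod f \<alpha>) \<notin> Q L"
      by (rule chain_witnesses_independent[where c=c and n=n]) (use that prime strict f in auto)
    then show ?thesis using poly_ring_idealD(2)[OF primeidealD(1)[OF prime[of L]]] by auto
  qed
  have count: "(t + 1) ^ L \<le> (d * (L * t) + 1) ^ (c * n)" for t
  proof -
    define T where "T = {\<alpha>. set \<alpha> \<subseteq> {0..t} \<and> length \<alpha> = L}"
    have T: "finite T" "card T = (t + 1) ^ L"
      unfolding T_def by (simp_all add: finite_lists_length_eq card_lists_length_eq)
    \<comment> \<open>Equal products for two exponent lists would be a relation with coefficients 1
      and -1. Injectivity is what lets card T count the independent family.\<close>
    have inj: "inj_on (power_prod f) T"
    proof (rule inj_onI, rule ccontr)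
      fix \<alpha> \<beta> assume \<alpha>\<beta>: "\<alpha> \<in> T" "\<beta> \<in> T" "power_prod f \<alpha> = power_prod f \<beta>" "\<alpha> \<noteq> \<beta>"
      have "(\<Sum>\<gamma>\<in>{\<alpha>, \<beta>}. single 0 (if \<gamma> = \<alpha> then 1 else - 1 :: 'a) * power_prod f \<gamma>) \<noteq> 0"
        by (rule nonzero) (use \<alpha>\<beta> in \<open>auto simp: T_def\<close>)
      then show False using \<alpha>\<beta>(3,4) by (auto simp: single_uminus)
    qed
    have "vs.independent (power_prod f ` T)"
    proof (rule vs.independent_if_scalars_zero)
      show "finite (power_prod f ` T)" using T by simp
      fix u x assume 0: "(\<Sum>g\<in>power_prod f ` T. single 0 (u g) * g) = 0" and x: "x \<in> power_prod f ` T"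
      define A where "A = {\<alpha>\<in>T. u (power_prod f \<alpha>) \<noteq> 0}"
      have "(\<Sum>\<alpha>\<in>A. single 0 (u (power_prod f \<alpha>)) * power_prod f \<alpha>) =
          (\<Sum>\<alpha>\<in>T. single 0 (u (power_prod f \<alpha>)) * power_prod f \<alpha>)"
        by (rule sum.mono_neutral_left) (use T in \<open>auto simp: A_def\<close>)
      also have "\<dots> = 0" using 0 by (simp add: sum.reindex[OF inj])
      finally have "(\<Sum>\<alpha>\<in>A. single 0 (u (power_prod f \<alpha>)) * power_prod f \<alpha>) = 0" .
      moreover have "finite A" using T(1) by (simp add: A_def)
      moreover have "length \<alpha> = L \<and> u (power_prod f \<alpha>) \<noteq> 0" if "\<alpha> \<in> A" for \<alpha>
        using that by (simp add: A_def T_def)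
      ultimately have "A = {}" using nonzero[of A "\<lambda>\<alpha>. u (power_prod f \<alpha>)"] by blast
      then show "u x = 0" using x by (auto simp: A_def)
    qed
    moreover have "power_prod f ` T \<subseteq> vs.span (mono_poly ` box c n (d * (L * t)))"
    proof (rule image_subsetI)
      fix \<alpha> assume \<alpha>: "\<alpha> \<in> T"
      have "sum_list \<alpha> \<le> L * t"
        using \<alpha> sum_list_mono[of \<alpha> "\<lambda>x. x" "\<lambda>x. t"] by (auto simp: T_def sum_list_triv subset_iff)
      then have "d * sum_list \<alpha> \<le> d * (L * t)" by simp
      moreover have "keys (power_prod f \<alpha>) \<subseteq> box c n (d * sum_list \<alpha>)"
        by (rule keys_power_prod_box) (use \<alpha> d in \<open>auto simp: T_def\<close>)
      ultimately have k: "keys (power_prod f \<alpha>) \<subseteq> box c n (d * (L * t))"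
        unfolding box_def using order_trans by blast
      have "(\<Sum>u\<in>keys (power_prod f \<alpha>). single u (lookup (power_prod f \<alpha>) u)) \<in> vs.span (mono_poly ` box c n (d * (L * t)))"
      proof (rule vs.span_sum)
        fix u assume "u \<in> keys (power_prod f \<alpha>)"
        then have "single 0 (lookup (power_prod f \<alpha>) u) * mono_poly u \<in> vs.span (mono_poly ` box c n (d * (L * t)))"
          using k by (intro vs.span_scale vs.span_base) auto
        then show "single u (lookup (power_prod f \<alpha>) u) \<in> vs.span (mono_poly ` box c n (d * (L * t)))"
          by (simp add: mono_poly_def mult_single)
      qed
      then show "power_prod f \<alpha> \<in> vs.span (mono_poly ` box c n (d * (L * t)))"
        using poly_mapping_eq_sum_single[of "power_prod f \<alpha>"] by simp
    qed
    moreover have "finite ((mono_poly :: _ \<Rightarrow> 'a mpoly) ` box c n (d * (L * t)))" by (simp add: card_box)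
    ultimately have "card (power_prod f ` T) \<le> card ((mono_poly :: _ \<Rightarrow> 'a mpoly) ` box c n (d * (L * t)))"
      using vs.independent_span_bound by blast
    also have "\<dots> \<le> card (box c n (d * (L * t)))" by (rule card_image_le) (use card_box in blast)
    also have "\<dots> \<le> (d * (L * t) + 1) ^ (c * n)" using card_box by blast
    finally show ?thesis using T by (simp add: card_image[OF inj])
  qed
  show ?thesis
  proof (rule ccontr)
    assume "\<not> ?thesis"
    then have L: "Suc (c * n) \<le> L" by simp
    \<comment> \<open>Chosen so that the upper bound becomes t * (t + 1) ^ (c * n), just short of (t
      + 1) ^ (c * n + 1).\<close>
    define t where "t = (d * L + 1) ^ (c * n)"
    have "(t + 1) ^ Suc (c * n) \<le> (t + 1) ^ L" by (rule power_increasing[OF L]) simp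
    also have "\<dots> \<le> (d * (L * t) + 1) ^ (c * n)" by (rule count)
    also have "\<dots> \<le> ((d * L + 1) * (t + 1)) ^ (c * n)"
      by (rule power_mono) (simp_all add: algebra_simps)
    also have "\<dots> = t * (t + 1) ^ (c * n)" by (simp only: power_mult_distrib t_def)
    finally have "(t + 1) * (t + 1) ^ (c * n) \<le> t * (t + 1) ^ (c * n)" by simp
    then show False by simp
  qed
qed

text \<open>A chain ending in a variable ideal extends upwards by adding the remaining variables one at a
  time, and the extended chain has length at most \<open>c n\<close>.\<close>

lemma prime_height_var_ideal_le:
  assumes "W \<subseteq> vars c n"
  shows "prime_height (poly_ring c n) (var_ideal c n W :: 'a::field mpoly set) \<le> enat (card W)"
  unfolding prime_height_def
proof (rule SUP_least, clarify)
  fix l and Q :: "nat \<Rightarrow> 'a mpoly set"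
  assume prime: "\<forall>k\<le>l. primeideal (Q k) (poly_ring c n)" and strict: "\<forall>k<l. Q k \<subset> Q (Suc k)"
    and Ql: "Q l = var_ideal c n W"
  define m where "m = card (vars c n - W)"
  obtain e where e: "bij_betw e {..<m} (vars c n - W)"
    using ex_bij_betw_nat_finite[of "vars c n - W"] by (auto simp: m_def atLeast0LessThan)
  define C where "C k = (if k \<le> l then Q k else var_ideal c n (W \<union> e ` {..<k - l}))" for k
  have eV: "e j \<in> vars c n - W" if "j < m" for j using e that by (auto simp: bij_betw_def)
  have C_strict: "C k \<subset> C (Suc k)" if k: "k < l + m" for k
  proof (cases "k < l")
    case True
    then show ?thesis using strict by (simp add: C_def)
  next
    case False
    then have Ck: "C k = var_ideal c n (W \<union> e ` {..<k - l})" using Ql by (auto simp: C_def)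
    have km: "k - l < m" using False k by simp
    have "e (k - l) \<notin> e ` {..<k - l}"
      using inj_on_image_mem_iff[OF bij_betw_imp_inj_on[OF e], of "k - l" "{..<k - l}"] km by auto
    then have "e (k - l) \<notin> W \<union> e ` {..<k - l}" using eV[OF km] by blast
    moreover have "e ` {..<Suc k - l} = insert (e (k - l)) (e ` {..<k - l})"
      using False by (simp add: Suc_diff_le not_less lessThan_Suc)
    ultimately have "W \<union> e ` {..<k - l} \<subset> W \<union> e ` {..<Suc k - l}" by auto
    moreover have "e j \<in> vars c n" if "j < Suc k - l" for j
    proof -
      have "j < m" using that km by linarith
      then show ?thesis using eV by blast
    qed
    then have "W \<union> e ` {..<Suc k - l} \<subseteq> vars c n" using assms by blast
    ultimately have "var_ideal c n (W \<union> e ` {..<k - l}) \<subset> (var_ideal c n (W \<union> e ` {..<Suc k - l}) :: 'a mpoly set)"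
      by (rule var_ideal_strict_mono)
    moreover have "C (Suc k) = var_ideal c n (W \<union> e ` {..<Suc k - l})" using False by (simp add: C_def)
    ultimately show ?thesis unfolding Ck by simp
  qed
  \<comment> \<open>\<open>prime_chain_length_le\<close> is stated for decreasing chains, hence the
    reversed index. Since m + card W = c * n, what remains for the part below is l \<le> card
    W.\<close>
  have "l + m \<le> c * n"
  proof (rule prime_chain_length_le)
    show "primeideal (C (l + m - k)) (poly_ring c n)" for k
      using prime var_ideal_prime by (auto simp: C_def)
    show "C (l + m - Suc k) \<subset> C (l + m - k)" if "k < l + m" for k
      using C_strict[of "l + m - Suc k"] that by (simp add: Suc_diff_Suc)
  qed
  moreover have "m + card W = c * n"
  proof -
    have "finite W" by (rule finite_subset[OF assms]) simp
    then have "m = card (vars c n) - card W" unfolding m_def by (rule card_Diff_subset) (rule assms)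
    moreover have "card W \<le> card (vars c n)" by (rule card_mono[OF _ assms]) simp
    ultimately show ?thesis by (simp add: card_cartesian_product)
  qed
  ultimately show "enat l \<le> enat (card W)" by simp
qed

lemma prime_height_ge:
  assumes P: "primeideal P (poly_ring c n :: 'a::field mpoly ring)"
    and W: "W \<subseteq> vars c n" "\<And>x. x \<in> W \<Longrightarrow> single x 1 \<in> monomials P"
  shows "enat (card W) \<le> prime_height (poly_ring c n) P"
proof -
  obtain e where e: "bij_betw e {..<card W} W"
    using ex_bij_betw_nat_finite[of W] finite_subset[OF W(1)] by (auto simp: atLeast0LessThan)
  \<comment> \<open>The last member is P itself and not the variable ideal of W, which P may contain
    strictly; the last step stays strict since P contains that ideal.\<close>
  define Q where "Q k = (if k < card W then var_ideal c n (e ` {..<k}) else P)" for k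
  have sub: "var_ideal c n W \<subseteq> P"
    by (rule var_ideal_subset[OF primeidealD(1)[OF P]]) (use W(2) in blast)
  have "Q k \<subset> Q (Suc k)" if k: "k < card W" for k
  proof -
    have "e k \<notin> e ` {..<k}"
      using inj_on_image_mem_iff[OF bij_betw_imp_inj_on[OF e], of k "{..<k}"] k by auto
    then have "e ` {..<k} \<subset> e ` {..<Suc k}" by (auto simp: lessThan_Suc)
    moreover have "e ` {..<Suc k} \<subseteq> W" using e k by (auto simp: bij_betw_def)
    ultimately have *: "var_ideal c n (e ` {..<k}) \<subset> (var_ideal c n (e ` {..<Suc k}) :: 'a mpoly set)"
      using W(1) by (intro var_ideal_strict_mono) auto
    show ?thesis
    proof (cases "Suc k < card W")
      case False
      then have "Suc k = card W" using k by simp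
      then have "e ` {..<Suc k} = W" using e by (auto simp: bij_betw_def)
      then show ?thesis using * sub False k by (auto simp: Q_def)
    qed (use * in \<open>simp add: Q_def\<close>)
  qed
  moreover have "primeideal (Q k) (poly_ring c n)" for k using P var_ideal_prime by (auto simp: Q_def)
  moreover have "Q (card W) = P" by (simp add: Q_def)
  ultimately show ?thesis unfolding prime_height_def by (intro SUP_upper) blast
qed

lemma codim_monomial_ideal:
  fixes J :: "'a::field mpoly set"
  assumes J: "monomial_ideal c n J"
    and W: "W \<subseteq> vars c n" "\<And>u. u \<in> monomials J \<Longrightarrow> keys u \<inter> W \<noteq> {}"
    and W_min: "\<And>W'. W' \<subseteq> vars c n \<Longrightarrow> (\<And>u. u \<in> monomials J \<Longrightarrow> keys u \<inter> W' \<noteq> {}) \<Longrightarrow> card W \<le> card W'"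
  shows "codim (poly_ring c n) J = enat (card W)"
proof (rule antisym)
  have "J \<subseteq> var_ideal c n W"
    by (subst monomial_ideal_supported(1)[OF J]) (use W(2) in \<open>auto simp: var_ideal_def supported_def\<close>)
  then show "codim (poly_ring c n) J \<le> enat (card W)"
    unfolding codim_def
    by (intro INF_lower2[where f = "prime_height (poly_ring c n)" and i = "var_ideal c n W"]
        prime_height_var_ideal_le W(1)) (simp add: var_ideal_prime)
  show "enat (card W) \<le> codim (poly_ring c n) J"
    unfolding codim_def
  proof (rule INF_greatest, clarify)
    fix P :: "'a mpoly set" assume P: "primeideal P (poly_ring c n)" "J \<subseteq> P"
    \<comment> \<open>The variables lying in P meet the support of each monomial of J, so W'
      competes with W in the minimality assumption.\<close>
    define W' where "W' = {x \<in> vars c n. single x 1 \<in> monomials P}"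
    have "card W \<le> card W'"
    proof (rule W_min)
      fix u assume "u \<in> monomials J"
      then have "u \<in> monomials P" "u \<in> power_products c n"
        using P(2) monomial_ideal_supported(2)[OF J] by (auto simp: monomials_def)
      then show "keys u \<inter> W' \<noteq> {}"
        using prime_monomial_has_var[OF P(1), of u] by (auto simp: W'_def power_products_def)
    qed (auto simp: W'_def)
    also have "enat (card W') \<le> prime_height (poly_ring c n) P"
      by (rule prime_height_ge[OF P(1)]) (auto simp: W'_def)
    finally show "enat (card W) \<le> prime_height (poly_ring c n) P" by simp
  qed
qed

lemma codim_carrier: "codim (poly_ring c n) (carrier (poly_ring c n) :: 'a::field mpoly set) = \<infinity>"
proof -
  have "\<not> (primeideal P (poly_ring c n) \<and> carrier (poly_ring c n) \<subseteq> P)" for P :: "'a mpoly set"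
    using primeidealD(2)[of P c n] subsetD[of "carrier (poly_ring c n)" P 1] by auto
  then have "{P. primeideal P (poly_ring c n) \<and> carrier (poly_ring c n) \<subseteq> P} = ({} :: 'a mpoly set set)" by blast
  then show ?thesis unfolding codim_def by (simp only: image_empty Inf_empty top_enat_def)
qed

section \<open>Invariant chains of monomial ideals\<close>

lemma embeddings_imp_Inc_mn:
  assumes \<rho>: "\<rho> \<in> embeddings i r n" and r: "r \<ge> 1"
  shows "\<exists>\<pi>\<in>Inc_mn i r n. \<forall>j\<in>{1..r}. \<pi> j = \<rho> j"
proof -
  have mono: "strict_mono_on {1..r} \<rho>" and range: "\<And>j. j \<in> {1..r} \<Longrightarrow> 1 \<le> \<rho> j \<and> \<rho> j \<le> n"
    and fix_i: "\<And>j. j \<in> {1..r} \<Longrightarrow> j \<le> i \<Longrightarrow> \<rho> j = j"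
    using \<rho> by (auto simp: embeddings_def)
  define \<pi> where "\<pi> j = (if j \<le> r then \<rho> j else \<rho> r + (j - r))" for j
  have "\<pi> x < \<pi> y" if "1 \<le> x" "x < y" for x y
  proof -
    have "\<rho> x < \<rho> y" if "y \<le> r" using strict_mono_onD[OF mono, of x y] that \<open>1 \<le> x\<close> \<open>x < y\<close> by auto
    moreover have "\<rho> x \<le> \<rho> r" if "x \<le> r"
      using strict_mono_onD[OF mono, of x r] that \<open>1 \<le> x\<close> r by (cases "x = r") auto
    ultimately show ?thesis using \<open>x < y\<close> by (auto simp: \<pi>_def)
  qed
  moreover have "1 \<le> \<pi> j" if "1 \<le> j" for j using range[of j] range[of r] that r by (auto simp: \<pi>_def)
  \<comment> \<open>For r < j \<le> i the position r is itself fixed, so the shift beyond r is the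
    identity.\<close>
  moreover have "\<pi> j = j" if "1 \<le> j" "j \<le> i" for j
    using fix_i[of j] fix_i[of r] that r by (auto simp: \<pi>_def)
  moreover have "\<pi> r \<le> n" using range[of r] r by (simp add: \<pi>_def)
  ultimately have "\<pi> \<in> Inc_mn i r n" by (auto simp: Inc_mn_def Inc_def strict_mono_on_def)
  then show ?thesis by (rule bexI[rotated]) (simp add: \<pi>_def)
qed

lemma Inc_mn_imp_embeddings:
  assumes "\<pi> \<in> Inc_mn i r n"
  shows "\<pi> \<in> embeddings i r n"
proof -
  have mono: "strict_mono_on {1..} \<pi>" and pos: "\<And>j. 1 \<le> j \<Longrightarrow> 1 \<le> \<pi> j" and r: "\<pi> r \<le> n"
    and fix_i: "\<And>j. 1 \<le> j \<Longrightarrow> j \<le> i \<Longrightarrow> \<pi> j = j"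
    using assms by (auto simp: Inc_mn_def Inc_def)
  have "\<pi> j \<le> n" if "1 \<le> j" "j \<le> r" for j
    using strict_mono_onD[OF mono, of j r] that r by (cases "j = r") auto
  moreover have "strict_mono_on {1..r} \<pi>" using mono by (rule monotone_on_subset) auto
  ultimately show ?thesis using pos fix_i by (auto simp: embeddings_def)
qed

text \<open>This routes a map through an intermediate level, so that a monomial of level m can first
  be moved into the ideal at level r.\<close>

lemma Inc_mn_factor:
  assumes \<pi>: "\<pi> \<in> Inc_mn i m n" and m: "1 \<le> m" "m \<le> r" "r \<le> n"
  shows "\<exists>\<sigma>\<in>Inc_mn i m r. \<exists>\<tau>\<in>Inc_mn i r n. \<forall>j\<ge>1. \<tau> (\<sigma> j) = \<pi> j"
proof -
  have mono: "\<And>x y. 1 \<le> x \<Longrightarrow> x < y \<Longrightarrow> \<pi> x < \<pi> y" and pos: "\<And>j. 1 \<le> j \<Longrightarrow> 1 \<le> \<pi> j" and n: "\<pi> m \<le> n"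
    and fix_i: "\<And>j. 1 \<le> j \<Longrightarrow> j \<le> i \<Longrightarrow> \<pi> j = j"
    using \<pi> by (auto simp: Inc_mn_def Inc_def strict_mono_on_def)
  have shift: "\<pi> x + (y - x) \<le> \<pi> y" if "1 \<le> x" "x \<le> y" for x y
    using that(2)
  proof (induction rule: dec_induct)
    case (step k)
    then show ?case using mono[of k "Suc k"] that by auto
  qed simp
  define q where "q = r - m"
  \<comment> \<open>\<sigma> follows \<pi> but lags so as to move no position by more than q, which
    keeps \<sigma> m \<le> r. If it lags at j, then \<tau> reads \<pi> j off at j + q. Otherwise
    \<tau> must fix \<pi> j, and the maximum does so: \<pi> j - q \<le> j gives \<pi> (\<pi> j - q)
    \<le> \<pi> j.\<close>
  define \<sigma> where "\<sigma> j = min (\<pi> j) (j + q)" for j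
  define \<tau> where "\<tau> y = (if y \<le> q then y else max y (\<pi> (y - q)))" for y
  have "\<sigma> \<in> Inc_mn i m r"
    using mono pos fix_i m by (force simp: Inc_mn_def Inc_def strict_mono_on_def \<sigma>_def q_def min_def)
  moreover have "\<tau> \<in> Inc_mn i r n"
    unfolding Inc_mn_def Inc_def mem_Collect_eq
  proof (intro conjI ballI strict_mono_onI)
    fix x y :: nat assume xy: "x \<in> {1..}" "y \<in> {1..}" "x < y"
    have "\<pi> (x - q) < \<pi> (y - q)" if "q < x" using mono that xy by auto
    then show "\<tau> x < \<tau> y" using xy by (auto simp: \<tau>_def max_def not_le)
  next
    fix j assume "j \<in> {1..i}"
    then show "\<tau> j = j" using fix_i[of "j - q"] by (auto simp: \<tau>_def max_def)
  next
    show "\<tau> r \<le> n" using n m by (auto simp: \<tau>_def q_def)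
  qed (auto simp: \<tau>_def)
  moreover have "\<tau> (\<sigma> j) = \<pi> j" if j: "1 \<le> j" for j
  proof (cases "\<pi> j \<le> j + q")
    case True
    have "\<pi> (\<pi> j - q) \<le> \<pi> j" if "q < \<pi> j"
      using shift[of "\<pi> j - q" j] True that by linarith
    then show ?thesis using True by (auto simp: \<sigma>_def \<tau>_def max_def)
  next
    case False
    then show ?thesis using j by (auto simp: \<sigma>_def \<tau>_def)
  qed
  ultimately show ?thesis by blast
qed

section \<open>The action of increasing maps on monomials\<close>

lemma lookup_act_pp: "lookup (act_pp \<pi> u) y = (\<Sum>x\<in>keys u. if map_prod id \<pi> x = y then lookup u x else 0)"
  by (auto simp: act_pp_def lookup_sum lookup_single when_def map_prod_def split_beta intro!: sum.cong)

lemma keys_act_pp: "keys (act_pp \<pi> u) = map_prod id \<pi> ` keys u"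
proof (rule Set.set_eqI)
  fix y
  have "y \<in> keys (act_pp \<pi> u) \<longleftrightarrow> (\<exists>x\<in>keys u. (if map_prod id \<pi> x = y then lookup u x else 0) \<noteq> 0)"
    unfolding in_keys_iff[of y] lookup_act_pp sum_eq_0_iff[OF finite_keys]
    by (simp only: Set.ball_simps)
  also have "\<dots> \<longleftrightarrow> y \<in> map_prod id \<pi> ` keys u" by (metis image_iff in_keys_iff)
  finally show "y \<in> keys (act_pp \<pi> u) \<longleftrightarrow> y \<in> map_prod id \<pi> ` keys u" .
qed

lemma lookup_act_pp_image:
  assumes "inj_on \<pi> {1..m}" "u \<in> power_products c m" "x \<in> keys u"
  shows "lookup (act_pp \<pi> u) (map_prod id \<pi> x) = lookup u x"
proof -
  have "map_prod id \<pi> x' = map_prod id \<pi> x \<longleftrightarrow> x' = x" if "x' \<in> keys u" for x'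
  proof -
    have "snd x' \<in> {1..m}" "snd x \<in> {1..m}"
      using assms(2,3) that by (auto simp: power_products_def simp del: atLeastAtMost_iff)
    then show ?thesis
      using inj_on_eq_iff[OF assms(1), of "snd x'" "snd x"] by (simp add: map_prod_def case_prod_beta prod_eq_iff)
  qed
  then have "lookup (act_pp \<pi> u) (map_prod id \<pi> x) = (\<Sum>x'\<in>keys u. if x' = x then lookup u x' else 0)"
    unfolding lookup_act_pp by (intro sum.cong) auto
  also have "\<dots> = lookup u x" using assms(3) by simp
  finally show ?thesis .
qed

lemma act_pp_addsI:
  assumes "inj_on \<pi> {1..m}" "u \<in> power_products c m"
    and le: "\<And>x. x \<in> keys u \<Longrightarrow> lookup u x \<le> lookup v (map_prod id \<pi> x)"
  shows "adds (act_pp \<pi> u) v"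
  unfolding adds_def
proof
  fix y
  show "lookup (act_pp \<pi> u) y \<le> lookup v y"
  proof (cases "y \<in> keys (act_pp \<pi> u)")
    case True
    then obtain x where x: "x \<in> keys u" "y = map_prod id \<pi> x" by (auto simp: keys_act_pp)
    then show ?thesis using lookup_act_pp_image[OF assms(1,2) x(1)] le by simp
  qed (simp add: in_keys_iff)
qed

lemma act_mono_poly: "act \<pi> (mono_poly u :: 'a::field mpoly) = mono_poly (act_pp \<pi> u)"
  by (simp add: act_def mono_poly_def)

text \<open>Only an inclusion, since for an arbitrary map terms may collide and cancel.\<close>

lemma keys_act: "keys (act \<pi> f) \<subseteq> act_pp \<pi> ` keys f"
proof
  fix v assume v: "v \<in> keys (act \<pi> f)"
  have "lookup (act \<pi> f) v = (\<Sum>u\<in>keys f. lookup f u when act_pp \<pi> u = v)"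
    by (simp add: act_def lookup_sum lookup_single)
  also have "\<dots> = 0" if "v \<notin> act_pp \<pi> ` keys f"
    by (rule sum.neutral) (use that in \<open>auto simp: when_def\<close>)
  finally show "v \<in> act_pp \<pi> ` keys f" using v by (auto simp: in_keys_iff)
qed

lemma embeddings_inj: "\<rho> \<in> embeddings i m n \<Longrightarrow> inj_on \<rho> {1..m}"
  by (simp add: embeddings_def strict_mono_on_imp_inj_on)

text \<open>A generator violates the cover condition iff its support lies in the rectangle over the
  rows outside C and the columns beyond i. Testing all monomials instead of the generators changes
  nothing: each monomial has a generator with smaller or equal support.\<close>

lemma is_cover_iff:
  fixes J :: "'a::field mpoly set"
  assumes J: "monomial_ideal c n J" and proper: "0 \<notin> monomials J"
  shows "is_cover c i n J C \<longleftrightarrow>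
    C \<subseteq> {1..c} \<and> (\<forall>u\<in>monomials J. \<not> keys u \<subseteq> ({1..c} - C) \<times> {i<..})"
proof -
  have sub: "monomials J \<subseteq> power_products c n" by (rule monomial_ideal_supported(2)[OF J])
  have gens: "min_gens c n J \<subseteq> monomials J" using min_gens_eq(1)[OF J] by blast
  have *: "(min_index u > i \<longrightarrow> covers C u) \<longleftrightarrow> \<not> keys u \<subseteq> ({1..c} - C) \<times> {i<..}" if u: "u \<in> monomials J" for u
  proof -
    \<comment> \<open>Properness matters here: \<open>min_index\<close> is a \<open>Min\<close>,
      which is unspecified for the empty support.\<close>
    have "keys u \<noteq> {}" using u proper by (metis keys_eq_empty)
    have "{j. \<exists>k. (k, j) \<in> keys u} = snd ` keys u" by force
    then have 1: "min_index u > i \<longleftrightarrow> (\<forall>x\<in>keys u. i < snd x)"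
      using \<open>keys u \<noteq> {}\<close> by (simp add: min_index_def)
    have kv: "x \<in> vars c n" if "x \<in> keys u" for x using u sub that by (auto simp: power_products_def)
    have 2: "covers C u \<longleftrightarrow> (\<exists>x\<in>keys u. fst x \<in> C)"
    proof
      assume "\<exists>x\<in>keys u. fst x \<in> C"
      then obtain k j where "(k, j) \<in> keys u" "k \<in> C" by auto
      then show "covers C u" using kv[of "(k, j)"] by (auto simp: covers_def)
    qed (force simp: covers_def)
    have "keys u \<subseteq> ({1..c} - C) \<times> {i<..} \<longleftrightarrow> (\<forall>x\<in>keys u. i < snd x \<and> fst x \<notin> C)"
      using kv unfolding subset_iff by (metis Diff_iff greaterThan_iff mem_Times_iff)
    then show ?thesis unfolding 1 2 by blast
  qed
  have "(\<forall>u\<in>min_gens c n J. \<not> keys u \<subseteq> X) \<longleftrightarrow> (\<forall>u\<in>monomials J. \<not> keys u \<subseteq> X)" for X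
    using min_gens_eq(2)[OF J] gens adds_keys by (meson order_trans subsetD)
  moreover have "(\<forall>u\<in>gens_above c i n J. covers C u) \<longleftrightarrow> (\<forall>u\<in>min_gens c n J. \<not> keys u \<subseteq> ({1..c} - C) \<times> {i<..})"
    using * gens unfolding gens_above_def by blast
  ultimately show ?thesis unfolding is_cover_def by simp
qed

section \<open>Stabilisation of the chain up to increasing maps\<close>

locale monomial_chain =
  fixes c i :: nat and I :: "nat \<Rightarrow> 'a::field mpoly set"
  assumes monomial: "\<And>n. n \<ge> 1 \<Longrightarrow> monomial_ideal c n (I n)"
    and invariant: "Inc_invariant i I"
begin

lemma act_pp_monomials:
  assumes "1 \<le> m" "m \<le> n" "u \<in> monomials (I m)" "\<pi> \<in> Inc_mn i m n"
  shows "act_pp \<pi> u \<in> monomials (I n)"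
  using invariant assms act_mono_poly[of \<pi> u, where 'a='a] unfolding Inc_invariant_def monomials_def
  by (metis mem_Collect_eq)

lemma monomials_sub: "1 \<le> n \<Longrightarrow> monomials (I n) \<subseteq> power_products c n"
  using monomial monomial_ideal_supported(2) by blast

text \<open>The images of all of \<open>I r\<close> generate the same ideal as the images of its
  monomials, so both sides of the equation are monomial ideals and may be compared on monomials.
  Invariance supplies one inclusion; the other is the divisibility condition.\<close>

lemma generated_iff:
  assumes r: "1 \<le> r" "r \<le> n"
  shows "I n = Idl\<^bsub>poly_ring c n\<^esub> {act \<pi> f |\<pi> f. f \<in> I r \<and> \<pi> \<in> Inc_mn i r n} \<longleftrightarrow>
    (\<forall>v\<in>monomials (I n). \<exists>u\<in>monomials (I r). \<exists>\<pi>\<in>Inc_mn i r n. adds (act_pp \<pi> u) v)"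
proof -
  interpret R: cring "poly_ring c n :: 'a mpoly ring" by (rule cring_poly_ring)
  have n: "1 \<le> n" using r by simp
  define G where "G = {act \<pi> f |\<pi> f. f \<in> I r \<and> \<pi> \<in> Inc_mn i r n}"
  define U where "U = {act_pp \<pi> u |\<pi> u. u \<in> monomials (I r) \<and> \<pi> \<in> Inc_mn i r n}"
  define X where "X = {v. \<exists>s\<in>U. adds s v}"
  have UI: "U \<subseteq> monomials (I n)" using act_pp_monomials[OF r] by (auto simp: U_def)
  then have Upp: "U \<subseteq> power_products c n" using monomials_sub[OF n] by blast
  have X: "ideal (supported c n X :: 'a mpoly set) (poly_ring c n)"
    unfolding X_def by (rule supported_ideal) (use adds_trans in blast)
  have GX: "G \<subseteq> supported c n X"
  proof
    fix g assume "g \<in> G"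
    then obtain \<pi> f where g: "g = act \<pi> f" "f \<in> I r" "\<pi> \<in> Inc_mn i r n" by (auto simp: G_def)
    have "keys f \<subseteq> monomials (I r)"
      using g(2) monomial_ideal_supported(1)[OF monomial[OF r(1)]] by (auto simp: supported_def)
    then have "keys g \<subseteq> U" using keys_act[of \<pi> f] g by (fastforce simp: U_def)
    then show "g \<in> supported c n X" using Upp adds_refl by (auto simp: supported_def X_def)
  qed
  have "mono_poly ` U \<subseteq> G"
  proof (rule image_subsetI)
    fix s assume "s \<in> U"
    then obtain \<pi> u where u: "s = act_pp \<pi> u" "mono_poly u \<in> I r" "\<pi> \<in> Inc_mn i r n"
      by (auto simp: U_def monomials_def)
    then have "act \<pi> (mono_poly u) \<in> G" unfolding G_def by blast
    then show "mono_poly s \<in> G" by (simp add: u(1) act_mono_poly)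
  qed
  moreover have GR: "G \<subseteq> carrier (poly_ring c n)" using GX by (auto simp: supported_def)
  ultimately have "Idl\<^bsub>poly_ring c n\<^esub> (mono_poly ` U) \<subseteq> Idl\<^bsub>poly_ring c n\<^esub> G"
    by (intro R.subset_Idl_subset)
  moreover have "Idl\<^bsub>poly_ring c n\<^esub> G \<subseteq> supported c n X" by (rule R.genideal_minimal[OF X GX])
  ultimately have G: "Idl\<^bsub>poly_ring c n\<^esub> G = supported c n X"
    using Idl_monomials[OF Upp, where 'a='a] by (auto simp: X_def)
  have "I n = supported c n X \<longleftrightarrow> monomials (I n) = power_products c n \<inter> X"
  proof
    assume "I n = supported c n X"
    then show "monomials (I n) = power_products c n \<inter> X" by (simp add: monomials_supported)
  next
    assume "monomials (I n) = power_products c n \<inter> X"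
    then show "I n = supported c n X"
      using monomial_ideal_supported(1)[OF monomial[OF n]] by (simp add: supported_def)
  qed
  also have "\<dots> \<longleftrightarrow> monomials (I n) \<subseteq> X"
  proof -
    have "ideal (I n) (poly_ring c n)" using monomial[OF n] by (simp add: monomial_ideal_def)
    then have "power_products c n \<inter> X \<subseteq> monomials (I n)"
      using UI monomials_adds unfolding X_def by blast
    then show ?thesis using monomials_sub[OF n] by blast
  qed
  also have "\<dots> \<longleftrightarrow> (\<forall>v\<in>monomials (I n). \<exists>u\<in>monomials (I r). \<exists>\<pi>\<in>Inc_mn i r n. adds (act_pp \<pi> u) v)"
    unfolding X_def U_def by blast
  finally show ?thesis using G by (simp add: G_def)
qed

text \<open>The letter at position \<open>j\<close> of the word of a monomial is the exponent vector of column \<open>j\<close>,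
  with \<open>min j (i + 1)\<close> stored at index \<open>0\<close>; as embeddings of words preserve this entry, they
  fix the first \<open>i\<close> positions.\<close>

definition word :: "nat \<Rightarrow> power_product \<Rightarrow> (nat \<Rightarrow> nat) list" where
  "word n u = map (\<lambda>j k. if k = 0 then min j (i + 1) else lookup u (k, j)) [1..<Suc n]"

definition letter_le :: "(nat \<Rightarrow> nat) \<Rightarrow> (nat \<Rightarrow> nat) \<Rightarrow> bool" where
  "letter_le x y \<longleftrightarrow> x 0 = y 0 \<and> (\<forall>k\<in>{1..c}. x k \<le> y k)"

lemma wqo_words: "wqo_on (list_emb letter_le) (lists {x. x 0 \<le> i + 1})"
proof (rule wqo_on_list_emb)
  have "finite ((\<lambda>x. x 0) ` {x :: nat \<Rightarrow> nat. x 0 \<le> i + 1})"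
    by (rule finite_subset[of _ "{..i + 1}"]) auto
  then have "wqo_on (\<lambda>x y. x 0 = y 0 \<and> (\<forall>k\<in>{1..c}. x k \<le> y k)) {x :: nat \<Rightarrow> nat. x 0 \<le> i + 1}"
    by (intro wqo_on_conj wqo_on_pullback_finite wqo_on_pointwise_le) auto
  then show "wqo_on letter_le {x. x 0 \<le> i + 1}" unfolding letter_le_def by simp
qed

lemma word_emb_imp_embedding:
  assumes "list_emb letter_le (word m u) (word n v)" "u \<in> power_products c m"
  shows "\<exists>\<rho>\<in>embeddings i m n. \<forall>x\<in>keys u. lookup u x \<le> lookup v (map_prod id \<rho> x)"
proof -
  have nth: "word n u ! j = (\<lambda>k. if k = 0 then min (Suc j) (i + 1) else lookup u (k, Suc j))" if "j < n" for n u j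
  proof -
    have "[1..<Suc n] ! j = Suc j" using that by (subst nth_upt) auto
    then show ?thesis using that unfolding word_def by (subst nth_map) auto
  qed
  have len: "length (word n u) = n" for n u by (simp add: word_def)
  obtain \<rho> where \<rho>: "strict_mono_on {..<m} \<rho>"
    "\<And>j. j < m \<Longrightarrow> \<rho> j < n \<and> letter_le (word m u ! j) (word n v ! \<rho> j)"
    using list_emb_imp_strict_mono_index[OF assms(1)] by (auto simp: len)
  have le: "min (Suc j) (i + 1) = min (Suc (\<rho> j)) (i + 1)" "k \<in> {1..c} \<Longrightarrow> lookup u (k, Suc j) \<le> lookup v (k, Suc (\<rho> j))"
    if "j < m" for j k
    using \<rho>(2)[OF that] that by (auto simp: letter_le_def nth)
  \<comment> \<open>Letters are indexed from 0, columns from 1.\<close>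
  define \<pi> where "\<pi> j = Suc (\<rho> (j - 1))" for j
  have "\<pi> \<in> embeddings i m n"
    unfolding embeddings_def mem_Collect_eq
  proof (intro conjI ballI impI strict_mono_onI)
    fix x y assume "x \<in> {1..m}" "y \<in> {1..m}" "x < y"
    then show "\<pi> x < \<pi> y" using strict_mono_onD[OF \<rho>(1), of "x - 1" "y - 1"] by (auto simp: \<pi>_def)
  next
    fix j assume j: "j \<in> {1..m}"
    then have "j - 1 < m" by auto
    then show "\<pi> j \<in> {1..n}" using \<rho>(2)[of "j - 1"] by (auto simp: \<pi>_def)
    assume "j \<le> i"
    then show "\<pi> j = j" using le(1)[OF \<open>j - 1 < m\<close>] j by (auto simp: \<pi>_def min_def split: if_splits)
  qed
  moreover have "lookup u x \<le> lookup v (map_prod id \<pi> x)" if "x \<in> keys u" for x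
  proof -
    obtain k j where x: "x = (k, j)" by (cases x)
    then have "k \<in> {1..c}" "j \<in> {1..m}" using assms(2) that by (auto simp: power_products_def)
    then show ?thesis using le(2)[of "j - 1" k] by (auto simp: x \<pi>_def)
  qed
  ultimately show ?thesis by blast
qed

text \<open>If no level were stable, every level r would have a monomial \<open>V r\<close> at a
  later level \<open>N r\<close> that no image from level r divides. Iterating N gives a sequence of
  such monomials, and Higman's lemma embeds an earlier one into a later one, which contradicts the
  novelty of the later one.\<close>

lemma stable_index_exists:
  "\<exists>r\<ge>1. \<forall>n\<ge>r. I n = Idl\<^bsub>poly_ring c n\<^esub> {act \<pi> f |\<pi> f. f \<in> I r \<and> \<pi> \<in> Inc_mn i r n}"
proof (rule ccontr)
  assume unstable: "\<not> ?thesis"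
  define new where "new r p \<longleftrightarrow> r \<le> fst p \<and> snd p \<in> monomials (I (fst p)) \<and>
      \<not> (\<exists>u\<in>monomials (I r). \<exists>\<pi>\<in>Inc_mn i r (fst p). adds (act_pp \<pi> u) (snd p))" for r p
  have "\<exists>p. new r p" if r: "1 \<le> r" for r
  proof -
    obtain n where n: "r \<le> n" "I n \<noteq> Idl\<^bsub>poly_ring c n\<^esub> {act \<pi> f |\<pi> f. f \<in> I r \<and> \<pi> \<in> Inc_mn i r n}"
      using unstable r by blast
    then obtain v where "new r (n, v)" using generated_iff[OF r n(1)] unfolding new_def by auto
    then show ?thesis ..
  qed
  then obtain p where p: "\<And>r. 1 \<le> r \<Longrightarrow> new r (p r)" by metis
  define N where "N r = fst (p r)" for r
  define V where "V r = snd (p r)" for r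
  have NV: "\<And>r. 1 \<le> r \<Longrightarrow> r \<le> N r" "\<And>r. 1 \<le> r \<Longrightarrow> V r \<in> monomials (I (N r))"
    "\<And>r u \<pi>. 1 \<le> r \<Longrightarrow> u \<in> monomials (I r) \<Longrightarrow> \<pi> \<in> Inc_mn i r (N r) \<Longrightarrow> \<not> adds (act_pp \<pi> u) (V r)"
    using p unfolding new_def N_def V_def by blast+
  \<comment> \<open>\<open>V (s k)\<close> lives at level \<open>s (Suc k)\<close>, so for k < l its
    level does not exceed \<open>s l\<close>, the level with respect to which \<open>V (s l)\<close>
    is new.\<close>
  define s where "s k = (N ^^ k) 1" for k
  have s_Suc: "s (Suc k) = N (s k)" for k by (simp add: s_def)
  have s1: "1 \<le> s k" for k
    by (induction k) (use NV(1) order_trans in \<open>auto simp: s_Suc, simp add: s_def\<close>)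
  have s_mono: "s k \<le> s l" if "k \<le> l" for k l
    by (rule lift_Suc_mono_le[OF _ that]) (unfold s_Suc, rule NV(1)[OF s1])
  have "range (\<lambda>k. word (s (Suc k)) (V (s k))) \<subseteq> lists {x. x 0 \<le> i + 1}" by (auto simp: word_def)
  then obtain k l where kl: "k < l" "list_emb letter_le (word (s (Suc k)) (V (s k))) (word (s (Suc l)) (V (s l)))"
    using wqo_words unfolding wqo_on_def by blast
  define m where "m = s (Suc k)"
  define u where "u = V (s k)"
  have m: "1 \<le> m" "m \<le> s l" "s l \<le> N (s l)" using s1 s_mono[of "Suc k" l] kl(1) NV(1) by (auto simp: m_def)
  have u: "u \<in> monomials (I m)" using NV(2)[OF s1[of k]] by (simp add: u_def m_def s_Suc)
  then have upp: "u \<in> power_products c m" using monomials_sub[OF m(1)] by blast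
  obtain \<rho> where \<rho>: "\<rho> \<in> embeddings i m (N (s l))" "\<And>x. x \<in> keys u \<Longrightarrow> lookup u x \<le> lookup (V (s l)) (map_prod id \<rho> x)"
    using word_emb_imp_embedding[OF kl(2)] upp by (auto simp: u_def m_def s_Suc)
  obtain \<pi> where \<pi>: "\<pi> \<in> Inc_mn i m (N (s l))" "\<And>j. j \<in> {1..m} \<Longrightarrow> \<pi> j = \<rho> j"
    using embeddings_imp_Inc_mn[OF \<rho>(1) m(1)] by blast
  \<comment> \<open>The embedding starts at level m, but novelty of \<open>V (s l)\<close> concerns
    images from level \<open>s l\<close>; \<sigma> first moves u there.\<close>
  obtain \<sigma> \<tau> where \<sigma>: "\<sigma> \<in> Inc_mn i m (s l)" and \<tau>: "\<tau> \<in> Inc_mn i (s l) (N (s l))"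
    and \<sigma>\<tau>: "\<And>j. 1 \<le> j \<Longrightarrow> \<tau> (\<sigma> j) = \<pi> j"
    using Inc_mn_factor[OF \<pi>(1) m] by blast
  have \<sigma>u: "act_pp \<sigma> u \<in> monomials (I (s l))" by (rule act_pp_monomials[OF m(1,2) u \<sigma>])
  have "adds (act_pp \<tau> (act_pp \<sigma> u)) (V (s l))"
  proof (rule act_pp_addsI)
    show "inj_on \<tau> {1..s l}" using \<tau> Inc_mn_imp_embeddings embeddings_inj by blast
    show "act_pp \<sigma> u \<in> power_products c (s l)" using \<sigma>u monomials_sub[OF s1] by blast
    fix y assume "y \<in> keys (act_pp \<sigma> u)"
    then obtain x where x: "x \<in> keys u" "y = map_prod id \<sigma> x" by (auto simp: keys_act_pp)
    have "lookup (act_pp \<sigma> u) y = lookup u x"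
      using lookup_act_pp_image[OF _ upp x(1)] embeddings_inj[OF Inc_mn_imp_embeddings[OF \<sigma>]] x(2) by simp
    also have "\<dots> \<le> lookup (V (s l)) (map_prod id \<rho> x)" by (rule \<rho>(2)[OF x(1)])
    also have "map_prod id \<rho> x = map_prod id \<tau> y"
      using x upp \<pi>(2) \<sigma>\<tau> by (cases x) (auto simp: power_products_def)
    finally show "lookup (act_pp \<sigma> u) y \<le> lookup (V (s l)) (map_prod id \<tau> y)" .
  qed
  then show False using NV(3)[OF s1 \<sigma>u \<tau>] by blast
qed

lemma chain_ind:
  "1 \<le> chain_ind c i I"
  "\<And>n. chain_ind c i I \<le> n \<Longrightarrow>
     I n = Idl\<^bsub>poly_ring c n\<^esub> {act \<pi> f |\<pi> f. f \<in> I (chain_ind c i I) \<and> \<pi> \<in> Inc_mn i (chain_ind c i I) n}"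
  using LeastI_ex[OF stable_index_exists] unfolding chain_ind_def by blast+

section \<open>Supports as a hypergraph, and the final count\<close>

lemma monomials_push:
  assumes "chain_ind c i I \<le> n" "u \<in> monomials (I (chain_ind c i I))" "\<rho> \<in> embeddings i (chain_ind c i I) n"
  shows "map_prod id \<rho> ` keys u \<in> keys ` monomials (I n)"
proof -
  let ?r = "chain_ind c i I"
  obtain \<pi> where \<pi>: "\<pi> \<in> Inc_mn i ?r n" "\<And>j. j \<in> {1..?r} \<Longrightarrow> \<pi> j = \<rho> j"
    using embeddings_imp_Inc_mn[OF assms(3) chain_ind(1)] by blast
  have "map_prod id \<rho> ` keys u = map_prod id \<pi> ` keys u"
    using monomials_sub[OF chain_ind(1)] assms(2) \<pi>(2)
    by (intro image_cong) (auto simp: power_products_def subset_iff)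
  then have "map_prod id \<rho> ` keys u = keys (act_pp \<pi> u)" by (simp add: keys_act_pp)
  then show ?thesis using act_pp_monomials[OF chain_ind(1) assms(1,2) \<pi>(1)] by blast
qed

lemma monomials_pull:
  assumes "chain_ind c i I \<le> n" "v \<in> monomials (I n)"
  shows "\<exists>u\<in>monomials (I (chain_ind c i I)). \<exists>\<rho>\<in>embeddings i (chain_ind c i I) n. map_prod id \<rho> ` keys u \<subseteq> keys v"
proof -
  let ?r = "chain_ind c i I"
  obtain u \<pi> where "u \<in> monomials (I ?r)" "\<pi> \<in> Inc_mn i ?r n" "adds (act_pp \<pi> u) v"
    using generated_iff[OF chain_ind(1) assms(1)] chain_ind(2)[OF assms(1)] assms(2) by blast
  then show ?thesis using adds_keys Inc_mn_imp_embeddings keys_act_pp by metis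
qed

lemma zero_monomial_iff:
  assumes "chain_ind c i I \<le> n"
  shows "0 \<in> monomials (I n) \<longleftrightarrow> 0 \<in> monomials (I (chain_ind c i I))"
proof
  assume "0 \<in> monomials (I n)"
  then show "0 \<in> monomials (I (chain_ind c i I))"
    using monomials_pull[OF assms] by fastforce
next
  assume 0: "0 \<in> monomials (I (chain_ind c i I))"
  have "id \<in> embeddings i (chain_ind c i I) n" using assms by (auto simp: embeddings_def strict_mono_on_def)
  from monomials_push[OF assms 0 this] have "{} \<in> keys ` monomials (I n)" by simp
  then show "0 \<in> monomials (I n)" by (metis imageE keys_eq_empty)
qed

lemma proper_imp_hypergraph_chain:
  assumes "0 \<notin> monomials (I (chain_ind c i I))"
  shows "hypergraph_chain c i (chain_ind c i I) (\<lambda>n. keys ` monomials (I n))"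
proof
  fix n F assume n: "chain_ind c i I \<le> n" and F: "F \<in> keys ` monomials (I n)"
  have "1 \<le> n" using n chain_ind(1) by simp
  then show "F \<subseteq> vars c n" using F monomials_sub[of n] by (auto simp: power_products_def subset_iff)
  show "\<exists>E\<in>keys ` monomials (I (chain_ind c i I)). \<exists>\<rho>\<in>embeddings i (chain_ind c i I) n. map_prod id \<rho> ` E \<subseteq> F"
    using monomials_pull[OF n] F by blast
next
  show "{} \<notin> keys ` monomials (I (chain_ind c i I))"
    using assms by (metis (no_types, lifting) imageE keys_eq_empty)
qed (use monomials_push in blast)

theorem codim_eventually_linear:
  "\<exists>D::int. \<exists>N::nat. \<forall>n\<ge>N.
    ereal_of_enat (codim (poly_ring c n) (I n)) =
      ereal_of_enat (chain_cover_number c i I) * ereal (real n) + ereal (real_of_int D)"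
proof (cases "0 \<in> monomials (I (chain_ind c i I))")
  case True
  have full: "I n = carrier (poly_ring c n)" if "chain_ind c i I \<le> n" for n
  proof -
    have "1 \<le> n" using chain_ind(1) that by simp
    then show ?thesis using monomial_ideal_proper_iff[OF monomial] zero_monomial_iff[OF that] True by blast
  qed
  then have cover: "cover_number c i n (I n) = \<infinity>" if "chain_ind c i I \<le> n" for n
    using that by (simp only: cover_number_def if_True refl)
  have "chain_cover_number c i I = \<infinity>"
    unfolding chain_cover_number_def by (rule the_equality) (use cover in auto)
  moreover have "codim (poly_ring c n) (I n) = \<infinity>" if "chain_ind c i I \<le> n" for n
    using codim_carrier full[OF that] by simp
  \<comment> \<open>Infinity times 0 is 0 in \<open>ereal\<close>, so the equation of infinite
    values needs a positive n.\<close>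
  moreover have "0 < n" if "chain_ind c i I \<le> n" for n using chain_ind(1) that by simp
  ultimately show ?thesis
    by (intro exI[of _ 0] exI[of _ "chain_ind c i I"]) auto
next
  case False
  define r where "r = chain_ind c i I"
  define H where "H n = keys ` monomials (I n)" for n
  interpret hypergraph_chain c i r H
    unfolding r_def H_def by (rule proper_imp_hypergraph_chain[OF False])
  \<comment> \<open>The i-covers, read off at level r through complementary rectangles;
    \<open>rectangle_edge_iff\<close> transports the condition to every later level.\<close>
  define K where "K = {C. C \<subseteq> {1..c} \<and> \<not> (\<exists>F\<in>H r. F \<subseteq> ({1..c} - C) \<times> {i<..})}"
  define \<gamma> where "\<gamma> = Min (card ` K)"
  have n1: "1 \<le> n" if "r \<le> n" for n using that chain_ind(1) by (simp add: r_def)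
  have cover: "cover_number c i n (I n) = enat \<gamma>" if n: "r \<le> n" for n
  proof -
    have proper: "0 \<notin> monomials (I n)" using zero_monomial_iff n False by (simp add: r_def)
    then have "I n \<noteq> carrier (poly_ring c n)" using monomial_ideal_proper_iff[OF monomial[OF n1[OF n]]] by blast
    moreover have "is_cover c i n (I n) C \<longleftrightarrow> C \<in> K" for C
      unfolding is_cover_iff[OF monomial[OF n1[OF n]] proper] K_def mem_Collect_eq
        rectangle_edge_iff[OF n, symmetric] by (auto simp: H_def)
    then have "{card C |C. is_cover c i n (I n) C} = card ` K" by auto
    ultimately show ?thesis by (simp only: cover_number_def if_False \<gamma>_def)
  qed
  have chain_cover: "chain_cover_number c i I = enat \<gamma>"
    unfolding chain_cover_number_def by (rule the_equality) (use cover in \<open>auto simp: r_def\<close>)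
  have "finite K" by (rule finite_subset[of _ "Pow {1..c}"]) (auto simp: K_def)
  \<comment> \<open>With all rows chosen, only an empty support could escape.\<close>
  have "{1..c} \<in> K" using nonempty by (auto simp: K_def)
  with \<open>finite K\<close> have "\<gamma> \<in> card ` K" unfolding \<gamma>_def by (intro Min_in) auto
  then obtain C where C: "C \<in> K" "card C = \<gamma>" by blast
  define A where "A = {1..c} - C"
  have Cc: "C \<subseteq> {1..c}" using C(1) by (simp add: K_def)
  have A_C: "card A + \<gamma> = c"
    using card_mono[OF _ Cc] C(2) card_Diff_subset[OF finite_subset[OF Cc] Cc] by (simp add: A_def)
  \<comment> \<open>A larger row set without an edge beyond i would have as its complement a cover
    with fewer than \<gamma> rows.\<close>
  have A_max: "\<exists>F\<in>H r. F \<subseteq> B \<times> {i<..}" if B: "B \<subseteq> {1..c}" "card A < card B" for B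
  proof (rule ccontr)
    assume "\<not> ?thesis"
    then have "{1..c} - B \<in> K" using B(1) by (simp add: K_def double_diff)
    then have "\<gamma> \<le> card ({1..c} - B)" unfolding \<gamma>_def using \<open>finite K\<close> by (intro Min_le) auto
    also have "\<dots> = c - card B" using card_Diff_subset[OF finite_subset[OF B(1)] B(1)] by simp
    finally show False using B(2) A_C card_mono[OF _ B(1)] by simp
  qed
  have A_K: "A \<subseteq> {1..c}" "\<And>F. F \<in> H r \<Longrightarrow> \<not> F \<subseteq> A \<times> {i<..}" using C(1) by (auto simp: A_def K_def)
  obtain D N where DN: "\<And>n. N \<le> n \<Longrightarrow> int (max_independent n) = int (card A) * int n + D"
    using max_independent_eventually_linear[OF A_K A_max] by blast
  have codim: "codim (poly_ring c n) (I n) = enat (c * n - max_independent n)" "max_independent n \<le> c * n"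
    if n: "r \<le> n" for n
  proof -
    obtain S where S: "S \<in> independent_sets n" "card S = max_independent n"
      using max_independent_attained[OF A_K A_max n] by blast
    then have Ssub: "S \<subseteq> vars c n" by (simp add: independent_sets_def)
    have card_compl: "card (vars c n - T) = c * n - card T" if "T \<subseteq> vars c n" for T
      using card_Diff_subset[OF finite_subset[OF that] that] by (simp add: card_cartesian_product)
    have card_le: "card T \<le> c * n" if "T \<subseteq> vars c n" for T
      using card_mono[OF _ that] by (simp add: card_cartesian_product)
    show "max_independent n \<le> c * n" using card_le[OF Ssub] S(2) by simp
    have kv: "keys u \<subseteq> vars c n" if "u \<in> monomials (I n)" for u
      using monomials_sub[OF n1[OF n]] that unfolding power_products_def by blast
    have "codim (poly_ring c n) (I n) = enat (card (vars c n - S))"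
    proof (rule codim_monomial_ideal[OF monomial[OF n1[OF n]]])
      show "keys u \<inter> (vars c n - S) \<noteq> {}" if "u \<in> monomials (I n)" for u
        using S(1) kv[OF that] that unfolding independent_sets_def H_def by blast
      fix W assume W: "W \<subseteq> vars c n" "\<And>u. u \<in> monomials (I n) \<Longrightarrow> keys u \<inter> W \<noteq> {}"
      have "vars c n - W \<in> independent_sets n" using W(2) unfolding independent_sets_def H_def by blast
      then have "card (vars c n - W) \<le> card S" using max_independent_ge S(2) by simp
      then show "card (vars c n - S) \<le> card W"
        using card_compl[OF Ssub] card_compl[OF W(1)] card_le[OF W(1)] by linarith
    qed blast
    then show "codim (poly_ring c n) (I n) = enat (c * n - max_independent n)"
      using card_compl[OF Ssub] S(2) by simp
  qed
  \<comment> \<open>The codimension is c * n minus the maximum, so D changes sign; card A + \<gamma>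
    = c turns the slope into \<gamma>.\<close>
  have "ereal_of_enat (codim (poly_ring c n) (I n)) =
      ereal_of_enat (chain_cover_number c i I) * ereal (real n) + ereal (real_of_int (- D))"
    if n: "max r N \<le> n" for n
  proof -
    have "int (c * n - max_independent n) = int c * int n - int (max_independent n)"
      using codim(2)[of n] n by (simp add: of_nat_diff)
    also have "\<dots> = int \<gamma> * int n - D"
      using DN[of n] n A_C[symmetric] by (simp add: algebra_simps)
    finally have "real_of_int (int (c * n - max_independent n)) = real_of_int (int \<gamma> * int n - D)" by (rule arg_cong)
    then have "real (c * n - max_independent n) = real \<gamma> * real n + real_of_int (- D)" by simp
    then show ?thesis using codim(1)[of n] n chain_cover by simp
  qed
  then show ?thesis by blast
qed

end

theorem theorem3p8:
  fixes c i :: nat and I :: "nat \<Rightarrow> 'a::field mpoly set"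
  assumes "c \<ge> 1"
    and "\<And>n. n \<ge> 1 \<Longrightarrow> monomial_ideal c n (I n)"
    and "Inc_invariant i I"
  shows "\<exists>D::int. \<exists>N::nat. \<forall>n\<ge>N.
    ereal_of_enat (codim (poly_ring c n) (I n)) =
      ereal_of_enat (chain_cover_number c i I) * ereal (real n) + ereal (real_of_int D)"
proof -
  interpret monomial_chain c i I by unfold_locales (use assms(2,3) in auto)
  show ?thesis by (rule codim_eventually_linear)
qed

end
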